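(* Let $L$ be a $5$-dimensional connected real Lie group with a left-invariant nearly integrable $\mathrm{SO}(3)$ structure $(g,\mathbb T)$, and let $K=\mathbb R^3$ or $K=\mathrm{SO}(3)$. Then the $\mathrm{SU}(3)$ structure $(\tilde g,\tilde{\mathbb T})$ on $L\times K$ is nearly integrable if and only if $\nabla_XX=0$ for all $X\in\mathfrak l$, where $\mathfrak l$ is the Lie algebra of $L$ and $\nabla$ the Levi-Civita connection of $g$.
   Context: A left-invariant $\mathrm{SO}(3)$ structure on a $5$-dimensional Lie group $L$ is given by a basis $e_1,\dots,e_5$ of the Lie algebra $\mathfrak l$ (the adapted frame, viewed as left-invariant vector fields, with dual coframe $e^1,\dots,e^5$): $g=\sum_i (e^i)^2$, and $\mathbb T$ is the left-invariant totally symmetric covariant $3$-tensor with, for $X=\sum x_ie_i$, $$\mathbb T(X,X,X)=x_1\bigl(3x_2^2+3x_4^2-x_1^2-\tfrac32x_3^2-\tfrac32x_5^2\bigr)+\tfrac{3\sqrt3}{2}x_4(x_5^2-x_3^2)+3\sqrt3\,x_2x_3x_5 .$$ It is nearly integrable if $(\nabla_X\mathbb T)(X,X,X)=0$ for all $X$. Let $e_6,e_7,e_8$ be a basis of the Lie algebra $\mathfrak k$ of $K$; for $K=\mathrm{SO}(3)$ it satisfies $[e_6,e_7]=e_8$, $[e_7,e_8]=e_6$, $[e_8,e_6]=e_7$. On $L\times K$ put the left-invariant metric $\tilde g=g+(e^6)^2+(e^7)^2+(e^8)^2$ and the left-invariant totally symmetric $3$-tensor $\tilde{\mathbb T}$ determined,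 for $\tilde X=\sum_{i=1}^8x_ie_i$, by $$\tilde{\mathbb T}(\tilde X,\tilde X,\tilde X)=\tfrac12\det\begin{pmatrix}x_1-\sqrt3x_4&\sqrt3(x_2+ix_8)&\sqrt3(x_3+ix_7)\\ \sqrt3(x_2-ix_8)&x_1+\sqrt3x_4&\sqrt3(x_5+ix_6)\\ \sqrt3(x_3-ix_7)&\sqrt3(x_5-ix_6)&-2x_1\end{pmatrix}.$$ Equivalently, $\tilde{\mathbb T}$ has components $\tilde t_{ijk}=t_{ijk}$ (the components of $\mathbb T$) for $i,j,k\le5$, $\tilde t_{166}=\tilde t_{177}=-\tfrac12$, $\tilde t_{188}=1$, $\tilde t_{466}=-\tilde t_{477}=\tilde t_{267}=-\tilde t_{368}=\tilde t_{578}=\tfrac{\sqrt3}2$, all others not obtained by symmetry being zero. The $\mathrm{SU}(3)$ structure $(\tilde g,\tilde{\mathbb T})$ is nearly integrable if $(\nabla_{\tilde X}\tilde{\mathbb T})(\tilde X,\tilde X,\tilde X)=0$ for all $\tilde X$, with $\nabla$ the Levi-Civita connection of $\tilde g$. *)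

theory Defs
  imports "HOL-Analysis.Analysis" "HOL-Algebra.Group"
begin

section \<open>Smooth manifolds\<close>

text \<open>The libraries have no smooth manifolds or Lie groups, so both are set up here.
  \<open>smooth_on S f\<close> (all iterated directional derivatives exist and are continuous) is meant
  for open \<open>S\<close>.\<close>

primrec Ck_on :: "nat \<Rightarrow> 'a::euclidean_space set \<Rightarrow> ('a \<Rightarrow> 'b::real_normed_vector) \<Rightarrow> bool" where
  "Ck_on 0 S f \<longleftrightarrow> continuous_on S f"
| "Ck_on (Suc k) S f \<longleftrightarrow> (\<forall>x\<in>S. f differentiable (at x)) \<and>
     (\<forall>v. Ck_on k S (\<lambda>x. frechet_derivative f (at x) v))"

definition smooth_on :: "'a::euclidean_space set \<Rightarrow> ('a \<Rightarrow> 'b::real_normed_vector) \<Rightarrow> bool" where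
  "smooth_on S f \<longleftrightarrow> (\<forall>k. Ck_on k S f)"

text \<open>An atlas is a set of pairs (domain, chart map); the values of a chart map outside its
  domain are irrelevant.  The dimension of the manifold is that of the model space \<open>'e\<close>.\<close>

record ('a, 'e) manifold =
  mtop :: "'a topology"
  atlas :: "('a set \<times> ('a \<Rightarrow> 'e)) set"

abbreviation points :: "('a, 'e, 'z) manifold_scheme \<Rightarrow> 'a set" where
  "points M \<equiv> topspace (mtop M)"

definition smooth_manifold :: "('a, 'e::euclidean_space) manifold \<Rightarrow> bool" where
  "smooth_manifold M \<longleftrightarrow>
     Hausdorff_space (mtop M) \<and> second_countable (mtop M) \<and>
     (\<Union>(U, \<phi>)\<in>atlas M. U) = points M \<and>
     (\<forall>(U, \<phi>)\<in>atlas M. openin (mtop M) U \<and> open (\<phi> ` U) \<and>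
        homeomorphic_map (subtopology (mtop M) U) (top_of_set (\<phi> ` U)) \<phi>) \<and>
     (\<forall>(U, \<phi>)\<in>atlas M. \<forall>(V, \<psi>)\<in>atlas M.
        smooth_on (\<phi> ` (U \<inter> V)) (\<psi> \<circ> inv_into U \<phi>))"

definition smooth_map ::
    "('a, 'e::euclidean_space) manifold \<Rightarrow> ('b, 'f::euclidean_space) manifold \<Rightarrow> ('a \<Rightarrow> 'b) \<Rightarrow> bool" where
  "smooth_map M N F \<longleftrightarrow> continuous_map (mtop M) (mtop N) F \<and>
     (\<forall>(U, \<phi>)\<in>atlas M. \<forall>(V, \<psi>)\<in>atlas N.
        smooth_on (\<phi> ` (U \<inter> F -` V)) (\<psi> \<circ> F \<circ> inv_into U \<phi>))"

definition smooth_fun_on :: "('a, 'e::euclidean_space) manifold \<Rightarrow> 'a set \<Rightarrow> ('a \<Rightarrow> real) \<Rightarrow> bool" where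
  "smooth_fun_on M U f \<longleftrightarrow> openin (mtop M) U \<and>
     (\<forall>(V, \<phi>)\<in>atlas M. smooth_on (\<phi> ` (U \<inter> V)) (f \<circ> inv_into V \<phi>))"

definition prod_manifold ::
    "('a, 'e::euclidean_space) manifold \<Rightarrow> ('b, 'f::euclidean_space) manifold \<Rightarrow> ('a \<times> 'b, 'e \<times> 'f) manifold" where
  "prod_manifold M N =
     \<lparr>mtop = prod_topology (mtop M) (mtop N),
      atlas = {(U \<times> V, map_prod \<phi> \<psi>) | U \<phi> V \<psi>. (U, \<phi>) \<in> atlas M \<and> (V, \<psi>) \<in> atlas N}\<rparr>"


section \<open>Tangent vectors and vector fields\<close>

text \<open>\<open>smooth_near M p\<close> is the set of real functions that are smooth in a neighbourhood of \<open>p\<close>.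
  A tangent vector at \<open>p\<close> is the functional on it given by a directional derivative
  \<open>\<Sum>\<^sub>i v\<^sub>i \<partial>/\<partial>x\<^sub>i\<close> in a chart, extended by \<open>0\<close> to the remaining functions, so that tangent vectors
  are determined by their values on \<open>smooth_near M p\<close> and are closed under pointwise linear
  combinations.\<close>

definition smooth_near :: "('a, 'e::euclidean_space) manifold \<Rightarrow> 'a \<Rightarrow> ('a \<Rightarrow> real) set" where
  "smooth_near M p = {f. \<exists>U. p \<in> U \<and> smooth_fun_on M U f}"

type_synonym 'a tangent_vector = "('a \<Rightarrow> real) \<Rightarrow> real"
type_synonym 'a vector_field = "'a \<Rightarrow> 'a tangent_vector"

definition tangent_space :: "('a, 'e::euclidean_space) manifold \<Rightarrow> 'a \<Rightarrow> 'a tangent_vector set" where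
  "tangent_space M p =
     {(\<lambda>f. if f \<in> smooth_near M p then frechet_derivative (f \<circ> inv_into U \<phi>) (at (\<phi> p)) v else 0)
      | U \<phi> v. (U, \<phi>) \<in> atlas M \<and> p \<in> U}"

text \<open>Vector fields are set to \<open>0\<close> outside the manifold, so that equality of vector fields is
  equality of functions.\<close>

definition vector_fields :: "('a, 'e::euclidean_space) manifold \<Rightarrow> 'a vector_field set" where
  "vector_fields M =
     {X. (\<forall>p\<in>points M. X p \<in> tangent_space M p) \<and>
         (\<forall>p. p \<notin> points M \<longrightarrow> X p = (\<lambda>f. 0)) \<and>
         (\<forall>U f. smooth_fun_on M U f \<longrightarrow> smooth_fun_on M U (\<lambda>p. X p f))}"

definition lie_bracket ::
    "('a, 'e::euclidean_space) manifold \<Rightarrow> 'a vector_field \<Rightarrow> 'a vector_field \<Rightarrow> 'a vector_field" where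
  "lie_bracket M X Y = (\<lambda>p f. if f \<in> smooth_near M p
     then X p (\<lambda>q. Y q f) - Y p (\<lambda>q. X q f) else 0)"

definition pushforward ::
    "('b, 'f::euclidean_space) manifold \<Rightarrow> ('a \<Rightarrow> 'b) \<Rightarrow> 'a \<Rightarrow> 'a tangent_vector \<Rightarrow> 'b tangent_vector" where
  "pushforward N F p v = (\<lambda>f. if f \<in> smooth_near N (F p) then v (f \<circ> F) else 0)"


section \<open>Levi-Civita connection\<close>

type_synonym 'a bilinear_tensor = "'a \<Rightarrow> 'a tangent_vector \<Rightarrow> 'a tangent_vector \<Rightarrow> real"
type_synonym 'a trilinear_tensor =
  "'a \<Rightarrow> 'a tangent_vector \<Rightarrow> 'a tangent_vector \<Rightarrow> 'a tangent_vector \<Rightarrow> real"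

definition field_add :: "'a vector_field \<Rightarrow> 'a vector_field \<Rightarrow> 'a vector_field" where
  "field_add X Y = (\<lambda>p f. X p f + Y p f)"

definition field_scale :: "('a \<Rightarrow> real) \<Rightarrow> 'a vector_field \<Rightarrow> 'a vector_field" where
  "field_scale h X = (\<lambda>p f. h p * X p f)"

definition affine_connection ::
    "('a, 'e::euclidean_space) manifold \<Rightarrow> ('a vector_field \<Rightarrow> 'a vector_field \<Rightarrow> 'a vector_field) \<Rightarrow> bool" where
  "affine_connection M D \<longleftrightarrow>
     (\<forall>X\<in>vector_fields M. \<forall>Y\<in>vector_fields M.
        D X Y \<in> vector_fields M \<and>
        (\<forall>Z\<in>vector_fields M. D (field_add X Y) Z = field_add (D X Z) (D Y Z) \<and>
                               D Z (field_add X Y) = field_add (D Z X) (D Z Y)) \<and>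
        (\<forall>h. smooth_fun_on M (points M) h \<longrightarrow>
           D (field_scale h X) Y = field_scale h (D X Y) \<and>
           D X (field_scale h Y) = field_add (field_scale (\<lambda>p. X p h) Y) (field_scale h (D X Y))))"

definition levi_civita ::
    "('a, 'e::euclidean_space) manifold \<Rightarrow> 'a bilinear_tensor \<Rightarrow>
     ('a vector_field \<Rightarrow> 'a vector_field \<Rightarrow> 'a vector_field) \<Rightarrow> bool" where
  "levi_civita M g D \<longleftrightarrow> affine_connection M D \<and>
     (\<forall>X\<in>vector_fields M. \<forall>Y\<in>vector_fields M.
        field_add (D X Y) (field_scale (\<lambda>p. -1) (D Y X)) = lie_bracket M X Y) \<and>
     (\<forall>X\<in>vector_fields M. \<forall>Y\<in>vector_fields M. \<forall>Z\<in>vector_fields M. \<forall>p\<in>points M.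
        X p (\<lambda>q. g q (Y q) (Z q)) = g p (D X Y p) (Z p) + g p (Y p) (D X Z p))"

definition cov_deriv ::
    "('a vector_field \<Rightarrow> 'a vector_field \<Rightarrow> 'a vector_field) \<Rightarrow> 'a vector_field \<Rightarrow> 'a trilinear_tensor \<Rightarrow>
     'a vector_field \<Rightarrow> 'a vector_field \<Rightarrow> 'a vector_field \<Rightarrow> 'a \<Rightarrow> real" where
  "cov_deriv D X T Y Z W p = X p (\<lambda>q. T q (Y q) (Z q) (W q))
     - T p (D X Y p) (Z p) (W p) - T p (Y p) (D X Z p) (W p) - T p (Y p) (Z p) (D X W p)"

definition nearly_integrable ::
    "('a, 'e::euclidean_space) manifold \<Rightarrow> ('a vector_field \<Rightarrow> 'a vector_field \<Rightarrow> 'a vector_field) \<Rightarrow>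
     'a trilinear_tensor \<Rightarrow> bool" where
  "nearly_integrable M D T \<longleftrightarrow>
     (\<forall>X\<in>vector_fields M. \<forall>p\<in>points M. cov_deriv D X T X X X p = 0)"


section \<open>Lie groups\<close>

definition lie_group :: "'a monoid \<Rightarrow> ('a, 'e::euclidean_space) manifold \<Rightarrow> bool" where
  "lie_group G M \<longleftrightarrow> group G \<and> smooth_manifold M \<and> carrier G = points M \<and>
     smooth_map (prod_manifold M M) M (\<lambda>(a, b). a \<otimes>\<^bsub>G\<^esub> b) \<and>
     smooth_map M M (\<lambda>a. inv\<^bsub>G\<^esub> a)"

definition lie_algebra :: "'a monoid \<Rightarrow> ('a, 'e::euclidean_space) manifold \<Rightarrow> 'a vector_field set" where
  "lie_algebra G M = {X \<in> vector_fields M.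
     \<forall>a\<in>carrier G. \<forall>p\<in>carrier G. pushforward M (\<lambda>q. a \<otimes>\<^bsub>G\<^esub> q) p (X p) = X (a \<otimes>\<^bsub>G\<^esub> p)}"

definition lie_algebra_basis ::
    "'a monoid \<Rightarrow> ('a, 'e::euclidean_space) manifold \<Rightarrow> nat set \<Rightarrow> (nat \<Rightarrow> 'a vector_field) \<Rightarrow> bool" where
  "lie_algebra_basis G M I e \<longleftrightarrow> finite I \<and> (\<forall>i\<in>I. e i \<in> lie_algebra G M) \<and>
     (\<forall>X\<in>lie_algebra G M. \<exists>!x. x \<in> extensional I \<and> X = (\<lambda>p f. \<Sum>i\<in>I. x i * e i p f))"

definition lie_isomorphic ::
    "'a monoid \<Rightarrow> ('a, 'e::euclidean_space) manifold \<Rightarrow> 'b monoid \<Rightarrow> ('b, 'f::euclidean_space) manifold \<Rightarrow> bool" where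
  "lie_isomorphic G M H N \<longleftrightarrow>
     (\<exists>F\<in>iso G H. smooth_map M N F \<and> smooth_map N M (inv_into (carrier G) F))"

definition R3_group :: "(real^3) monoid" where
  "R3_group = \<lparr>carrier = UNIV, mult = (+), one = 0\<rparr>"

definition R3_manifold :: "(real^3, real^3) manifold" where
  "R3_manifold = \<lparr>mtop = euclidean, atlas = {(UNIV, id)}\<rparr>"

definition SO3_group :: "(real^3^3) monoid" where
  "SO3_group = \<lparr>carrier = {A. orthogonal_matrix A \<and> det A = 1}, mult = (**), one = mat 1\<rparr>"

text \<open>The structure of an embedded submanifold: the charts are the inverses of all local
  parametrisations that are smooth immersions and homeomorphisms onto relatively open subsets.\<close>

definition SO3_manifold :: "(real^3^3, real^3) manifold" where
  "SO3_manifold = \<lparr>mtop = top_of_set (carrier SO3_group),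
     atlas = {(U, \<phi>). openin (top_of_set (carrier SO3_group)) U \<and> open (\<phi> ` U) \<and>
       homeomorphism U (\<phi> ` U) \<phi> (inv_into U \<phi>) \<and>
       smooth_on (\<phi> ` U) (inv_into U \<phi>) \<and>
       (\<forall>y\<in>\<phi> ` U. inj (frechet_derivative (inv_into U \<phi>) (at y)))}\<rparr>"


section \<open>Left-invariant structures given by an adapted frame\<close>

text \<open>\<open>frame_coord I e p v i\<close> is \<open>e\<^sup>i(v)\<close>, where \<open>(e\<^sup>i)\<close> is the coframe dual to the frame \<open>(e\<^sub>i)\<close>.
  Metrics and tensors with constant coefficients in a left-invariant frame are left-invariant.\<close>

definition frame_coord ::
    "nat set \<Rightarrow> (nat \<Rightarrow> 'a vector_field) \<Rightarrow> 'a \<Rightarrow> 'a tangent_vector \<Rightarrow> nat \<Rightarrow> real" where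
  "frame_coord I e p v = (THE x. x \<in> extensional I \<and> v = (\<lambda>f. \<Sum>i\<in>I. x i * e i p f))"

definition frame_metric :: "nat set \<Rightarrow> (nat \<Rightarrow> 'a vector_field) \<Rightarrow> 'a bilinear_tensor" where
  "frame_metric I e p u v = (\<Sum>i\<in>I. frame_coord I e p u i * frame_coord I e p v i)"

definition symmetric_3_tensor :: "('a, 'e::euclidean_space) manifold \<Rightarrow> 'a trilinear_tensor \<Rightarrow> bool" where
  "symmetric_3_tensor M T \<longleftrightarrow>
     (\<forall>p\<in>points M. \<forall>u\<in>tangent_space M p. \<forall>v\<in>tangent_space M p. \<forall>w\<in>tangent_space M p.
        T p u v w = T p v u w \<and> T p u v w = T p u w v \<and>
        (\<forall>z\<in>tangent_space M p. \<forall>a b. T p (\<lambda>f. a * u f + b * z f) v w = a * T p u v w + b * T p z v w))"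

definition so3_cubic :: "(nat \<Rightarrow> real) \<Rightarrow> real" where
  "so3_cubic x =
     x 1 * (3 * (x 2)\<^sup>2 + 3 * (x 4)\<^sup>2 - (x 1)\<^sup>2 - 3/2 * (x 3)\<^sup>2 - 3/2 * (x 5)\<^sup>2)
     + 3 * sqrt 3 / 2 * x 4 * ((x 5)\<^sup>2 - (x 3)\<^sup>2) + 3 * sqrt 3 * x 2 * x 3 * x 5"

definition su3_cubic :: "(nat \<Rightarrow> real) \<Rightarrow> complex" where
  "su3_cubic x = (let X = (\<lambda>i. complex_of_real (x i)); s = complex_of_real (sqrt 3) in
     1/2 * det (vector
       [vector [X 1 - s * X 4, s * (X 2 + \<i> * X 8), s * (X 3 + \<i> * X 7)],
        vector [s * (X 2 - \<i> * X 8), X 1 + s * X 4, s * (X 5 + \<i> * X 6)],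
        vector [s * (X 3 - \<i> * X 7), s * (X 5 - \<i> * X 6), - 2 * X 1]] :: complex^3^3))"

text \<open>The tensor \<open>T\<close> of the SO(3) structure, resp. SU(3) structure, with adapted frame \<open>e\<close>; the
  metric of the structure is \<open>frame_metric {1..5} e\<close>, resp. \<open>frame_metric {1..8} e\<close>.\<close>

definition so3_tensor ::
    "('a, 'e::euclidean_space) manifold \<Rightarrow> (nat \<Rightarrow> 'a vector_field) \<Rightarrow> 'a trilinear_tensor \<Rightarrow> bool" where
  "so3_tensor M e T \<longleftrightarrow> symmetric_3_tensor M T \<and>
     (\<forall>p\<in>points M. \<forall>v\<in>tangent_space M p. T p v v v = so3_cubic (frame_coord {1..5} e p v))"

definition su3_tensor ::
    "('a, 'e::euclidean_space) manifold \<Rightarrow> (nat \<Rightarrow> 'a vector_field) \<Rightarrow> 'a trilinear_tensor \<Rightarrow> bool" where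
  "su3_tensor M e T \<longleftrightarrow> symmetric_3_tensor M T \<and>
     (\<forall>p\<in>points M. \<forall>v\<in>tangent_space M p.
        complex_of_real (T p v v v) = su3_cubic (frame_coord {1..8} e p v))"

text \<open>The frame \<open>e\<^sub>1, \<dots>, e\<^sub>8\<close> of \<open>L \<times> K\<close> built from a frame \<open>e\<^sub>1, \<dots>, e\<^sub>5\<close> of \<open>L\<close> and a frame
  \<open>e\<^sub>6, e\<^sub>7, e\<^sub>8\<close> of \<open>K\<close>, i.e. \<open>(e\<^sub>i, 0)\<close> for \<open>i \<le> 5\<close> and \<open>(0, e\<^sub>i)\<close> for \<open>i > 5\<close>.\<close>

definition prod_frame ::
    "('a, 'e::euclidean_space) manifold \<Rightarrow> ('b, 'f::euclidean_space) manifold \<Rightarrow>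
     (nat \<Rightarrow> 'a vector_field) \<Rightarrow> (nat \<Rightarrow> 'b vector_field) \<Rightarrow> nat \<Rightarrow> ('a \<times> 'b) vector_field" where
  "prod_frame M N e k i = (\<lambda>(p, q).
     if i \<le> 5 then pushforward (prod_manifold M N) (\<lambda>x. (x, q)) p (e i p)
     else pushforward (prod_manifold M N) (\<lambda>y. (p, y)) q (k i q))"

end

theory Submission
  imports Defs
begin

text \<open>Let \<open>W\<^sub>l = \<langle>\<nabla>\<^sub>X X, e\<^sub>l\<rangle>\<close> for a left-invariant field \<open>X\<close> on \<open>L\<close>.  For \<open>X + Y\<close> with \<open>Y\<close> left-invariant
  on \<open>K\<close>, the \<open>K\<close>-component of \<open>\<nabla>\<^bsub>X + Y\<^esub> (X + Y)\<close> vanishes, because the structure constants of \<open>K\<close>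
  are zero or totally antisymmetric.  Expanding near integrability of the SU(3) structure at
  \<open>X + Y\<close> therefore gives the condition of the SO(3) structure, which holds by assumption, plus
  \<open>\<Sum>\<^sub>i W\<^sub>i q\<^sub>i(Y)\<close> with five quadratic forms \<open>q\<^sub>i\<close> in the three coordinates of \<open>Y\<close>.  These are linearly
  independent, so the condition is \<open>W = 0\<close>.

  All conditions are pointwise in a global orthonormal frame, so it does no harm that the
  structure functions are not known to be constant.  That the bracket of two fields is again a
  field comes with the existence of the Levi-Civita connection, which replaces the symmetry of
  second derivatives.\<close>

section \<open>Calculus of smooth maps\<close>

lemma Ck_on_subset: "Ck_on k S f \<Longrightarrow> T \<subseteq> S \<Longrightarrow> Ck_on k T f"
  by (induction k arbitrary: f) (auto intro: continuous_on_subset)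

lemma Ck_on_cong:
  assumes "open S" "\<And>x. x \<in> S \<Longrightarrow> f x = g x" "Ck_on k S f"
  shows "Ck_on k S g"
  using assms(2,3)
proof (induction k arbitrary: f g)
  case 0
  then show ?case by (auto cong: continuous_on_cong)
next
  case (Suc k)
  have d: "f differentiable (at x)" if "x \<in> S" for x
    using Suc.prems that by auto
  have g: "(g has_derivative frechet_derivative f (at x)) (at x)" if "x \<in> S" for x
    using d[OF that] assms(1) that Suc.prems(1)
    by (meson frechet_derivative_works has_derivative_transform_within_open)
  have eq: "frechet_derivative f (at x) = frechet_derivative g (at x)" if "x \<in> S" for x
    using g[OF that] by (rule frechet_derivative_at)
  have "Ck_on k S (\<lambda>x. frechet_derivative g (at x) v)" for v
    using Suc.IH[of "\<lambda>x. frechet_derivative f (at x) v"] Suc.prems(2) eq by simp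
  moreover have "g differentiable (at x)" if "x \<in> S" for x
    using g[OF that] by (auto simp: differentiable_def)
  ultimately show ?case by simp
qed

lemma Ck_on_Suc_derivI:
  assumes "open S" "\<And>x. x \<in> S \<Longrightarrow> (f has_derivative f' x) (at x)" "\<And>v. Ck_on k S (\<lambda>x. f' x v)"
  shows "Ck_on (Suc k) S f"
proof -
  have eq: "f' x = frechet_derivative f (at x)" if "x \<in> S" for x
    using assms(2)[OF that] by (rule frechet_derivative_at)
  have "Ck_on k S (\<lambda>x. frechet_derivative f (at x) v)" for v
    by (rule Ck_on_cong[OF assms(1) _ assms(3)[of v]]) (simp add: eq)
  then show ?thesis using assms(2) by (auto simp: differentiable_def)
qed

lemma Ck_on_SucD:
  assumes "Ck_on (Suc k) S f" "x \<in> S"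
  shows "(f has_derivative frechet_derivative f (at x)) (at x)"
  using assms frechet_derivative_works by auto

lemma Ck_on_Suc_imp: "Ck_on (Suc k) S f \<Longrightarrow> Ck_on k S f"
proof (induction k arbitrary: f)
  case 0
  then show ?case
    by (auto intro!: continuous_at_imp_continuous_on differentiable_imp_continuous_within)
next
  case (Suc k)
  then show ?case by (metis Ck_on.simps(2))
qed

lemma Ck_on_const: "Ck_on k S (\<lambda>x. c)"
  by (induction k arbitrary: c) auto

lemma Ck_on_linear_comp:
  assumes "open S" "bounded_linear L" "Ck_on k S f"
  shows "Ck_on k S (\<lambda>x. L (f x))"
  using assms(3)
proof (induction k arbitrary: f)
  case 0
  then show ?case using assms(2) by (auto intro: linear_continuous_on_compose bounded_linear.continuous_on)
next
  case (Suc k)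
  show ?case
  proof (rule Ck_on_Suc_derivI[OF assms(1)])
    show "((\<lambda>x. L (f x)) has_derivative (\<lambda>v. L (frechet_derivative f (at x) v))) (at x)" if "x \<in> S" for x
      using bounded_linear.has_derivative[OF assms(2) Ck_on_SucD[OF Suc.prems that]] .
    show "Ck_on k S (\<lambda>x. L (frechet_derivative f (at x) v))" for v
      using Suc by auto
  qed
qed

lemma Ck_on_add:
  assumes "open S" "Ck_on k S f" "Ck_on k S g"
  shows "Ck_on k S (\<lambda>x. f x + g x)"
  using assms(2,3)
proof (induction k arbitrary: f g)
  case 0
  then show ?case by (auto intro: continuous_on_add)
next
  case (Suc k)
  show ?case
  proof (rule Ck_on_Suc_derivI[OF assms(1)])
    show "((\<lambda>x. f x + g x) has_derivative
        (\<lambda>v. frechet_derivative f (at x) v + frechet_derivative g (at x) v)) (at x)" if "x \<in> S" for x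
      using has_derivative_add Suc.prems[THEN Ck_on_SucD] that by blast
    show "Ck_on k S (\<lambda>x. frechet_derivative f (at x) v + frechet_derivative g (at x) v)" for v
      using Suc by auto
  qed
qed

lemma Ck_on_bilinear:
  assumes "open S" "bounded_bilinear P" "Ck_on k S f" "Ck_on k S g"
  shows "Ck_on k S (\<lambda>x. P (f x) (g x))"
  using assms(3,4)
proof (induction k arbitrary: f g)
  case 0
  then show ?case by (auto intro: bounded_bilinear.continuous_on[OF assms(2)])
next
  case (Suc k)
  show ?case
  proof (rule Ck_on_Suc_derivI[OF assms(1)])
    show "((\<lambda>x. P (f x) (g x)) has_derivative
        (\<lambda>v. P (f x) (frechet_derivative g (at x) v) + P (frechet_derivative f (at x) v) (g x))) (at x)"
      if "x \<in> S" for x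
      using bounded_bilinear.FDERIV[OF assms(2)] Suc.prems[THEN Ck_on_SucD] that by blast
    show "Ck_on k S (\<lambda>x. P (f x) (frechet_derivative g (at x) v) + P (frechet_derivative f (at x) v) (g x))" for v
      using Suc.prems[THEN Ck_on_Suc_imp] Suc.prems
      by (intro Ck_on_add[OF assms(1)] Suc.IH) auto
  qed
qed

lemma Ck_on_inverse:
  fixes f :: "'a::euclidean_space \<Rightarrow> real"
  assumes "open S" "Ck_on k S f" "\<And>x. x \<in> S \<Longrightarrow> f x \<noteq> 0"
  shows "Ck_on k S (\<lambda>x. inverse (f x))"
  using assms(2)
proof (induction k)
  case 0
  then show ?case using assms(3) by (auto intro: continuous_on_inverse)
next
  case (Suc k)
  note i = Suc.IH[OF Ck_on_Suc_imp[OF Suc.prems]]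
  show ?case
  proof (rule Ck_on_Suc_derivI[OF assms(1)])
    show "((\<lambda>x. inverse (f x)) has_derivative
        (\<lambda>v. (- 1) * (inverse (f x) * frechet_derivative f (at x) v * inverse (f x)))) (at x)" if "x \<in> S" for x
      using Deriv.has_derivative_inverse[OF assms(3)[OF that] Ck_on_SucD[OF Suc.prems that]] by simp
    show "Ck_on k S (\<lambda>x. (- 1) * (inverse (f x) * frechet_derivative f (at x) v * inverse (f x)))" for v
      using Suc.prems by (intro Ck_on_bilinear[OF assms(1) bounded_bilinear_mult] Ck_on_const i) auto
  qed
qed

lemma Ck_on_affine_precomp:
  assumes "open T" "bounded_linear A" "Ck_on k S f" "\<And>x. x \<in> T \<Longrightarrow> c + A x \<in> S"
  shows "Ck_on k T (\<lambda>x. f (c + A x))"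
  using assms(3)
proof (induction k arbitrary: f)
  case 0
  have "continuous_on T (\<lambda>x. c + A x)"
    using assms(2) by (intro continuous_on_add continuous_on_const linear_continuous_on)
  then show ?case using 0 assms(4) continuous_on_compose2[of S f T "\<lambda>x. c + A x"] by auto
next
  case (Suc k)
  show ?case
  proof (rule Ck_on_Suc_derivI[OF assms(1)])
    show "((\<lambda>x. f (c + A x)) has_derivative (\<lambda>v. frechet_derivative f (at (c + A x)) (A v))) (at x)" if "x \<in> T" for x
    proof -
      have "((\<lambda>x. c + A x) has_derivative A) (at x)"
        using has_derivative_add[OF has_derivative_const bounded_linear_imp_has_derivative[OF assms(2)]] by simp
      from has_derivative_compose[OF this Ck_on_SucD[OF Suc.prems assms(4)[OF that]]]
      show ?thesis .
    qed
    show "Ck_on k T (\<lambda>x. frechet_derivative f (at (c + A x)) (A v))" for v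
      using Suc.IH[of "\<lambda>x. frechet_derivative f (at x) (A v)"] Suc.prems by auto
  qed
qed

lemma smooth_on_subset: "smooth_on S f \<Longrightarrow> T \<subseteq> S \<Longrightarrow> smooth_on T f"
  unfolding smooth_on_def using Ck_on_subset by blast

lemma smooth_on_cong:
  "open S \<Longrightarrow> (\<And>x. x \<in> S \<Longrightarrow> f x = g x) \<Longrightarrow> smooth_on S f \<Longrightarrow> smooth_on S g"
  unfolding smooth_on_def using Ck_on_cong by blast

lemma smooth_on_const [simp]: "smooth_on S (\<lambda>x. c)"
  by (simp add: smooth_on_def Ck_on_const)

lemma smooth_on_linear_comp:
  "open S \<Longrightarrow> bounded_linear L \<Longrightarrow> smooth_on S f \<Longrightarrow> smooth_on S (\<lambda>x. L (f x))"
  unfolding smooth_on_def using Ck_on_linear_comp by blast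

lemma smooth_on_add:
  "open S \<Longrightarrow> smooth_on S f \<Longrightarrow> smooth_on S g \<Longrightarrow> smooth_on S (\<lambda>x. f x + g x)"
  unfolding smooth_on_def using Ck_on_add by blast

lemma smooth_on_bilinear:
  "open S \<Longrightarrow> bounded_bilinear P \<Longrightarrow> smooth_on S f \<Longrightarrow> smooth_on S g \<Longrightarrow> smooth_on S (\<lambda>x. P (f x) (g x))"
  unfolding smooth_on_def using Ck_on_bilinear by blast

lemmas smooth_on_mult = smooth_on_bilinear[OF _ bounded_bilinear_mult]
  and smooth_on_scaleR = smooth_on_bilinear[OF _ bounded_bilinear_scaleR]
  and smooth_on_inner = smooth_on_bilinear[OF _ bounded_bilinear_inner]

lemma smooth_on_diff:
  assumes "open S" "smooth_on S f" "smooth_on S g"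
  shows "smooth_on S (\<lambda>x. f x - g x)"
  using smooth_on_add[OF assms(1,2) smooth_on_linear_comp[OF assms(1) bounded_linear_minus[OF bounded_linear_ident] assms(3)]]
  by simp

lemma smooth_on_sum:
  assumes "open S" "\<And>i. i \<in> I \<Longrightarrow> smooth_on S (f i)"
  shows "smooth_on S (\<lambda>x. \<Sum>i\<in>I. f i x)"
  using assms(2) by (induction I rule: infinite_finite_induct) (auto intro: smooth_on_add[OF assms(1)])

lemma smooth_on_divide:
  fixes f g :: "'a::euclidean_space \<Rightarrow> real"
  assumes "open S" "smooth_on S f" "smooth_on S g" "\<And>x. x \<in> S \<Longrightarrow> g x \<noteq> 0"
  shows "smooth_on S (\<lambda>x. f x / g x)"
  unfolding divide_inverse
  by (intro smooth_on_mult[OF assms(1,2)]) (use assms in \<open>auto simp: smooth_on_def intro: Ck_on_inverse\<close>)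

lemma smooth_on_affine_precomp:
  "open T \<Longrightarrow> bounded_linear A \<Longrightarrow> smooth_on S f \<Longrightarrow> (\<And>x. x \<in> T \<Longrightarrow> c + A x \<in> S) \<Longrightarrow>
    smooth_on T (\<lambda>x. f (c + A x))"
  unfolding smooth_on_def using Ck_on_affine_precomp by blast

lemma smooth_on_linear_precomp:
  "open T \<Longrightarrow> bounded_linear A \<Longrightarrow> smooth_on S f \<Longrightarrow> (\<And>x. x \<in> T \<Longrightarrow> A x \<in> S) \<Longrightarrow>
    smooth_on T (\<lambda>x. f (A x))"
  using smooth_on_affine_precomp[of T A S f 0] by simp

lemma smooth_on_Pair:
  assumes "open S" "smooth_on S f" "smooth_on S g"
  shows "smooth_on S (\<lambda>x. (f x, g x))"
proof -
  have "smooth_on S (\<lambda>x. (f x, 0) + (0, g x))"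
    using assms
    by (intro smooth_on_add smooth_on_linear_comp[of S "\<lambda>y. (y, 0)" f] smooth_on_linear_comp[of S "\<lambda>y. (0, y)" g]
        bounded_linear_Pair bounded_linear_ident bounded_linear_zero)
  then show ?thesis by simp
qed

lemma smooth_on_has_derivative:
  "smooth_on S f \<Longrightarrow> x \<in> S \<Longrightarrow> (f has_derivative frechet_derivative f (at x)) (at x)"
  unfolding smooth_on_def using Ck_on_SucD by blast

lemma smooth_on_frechet_derivative:
  "smooth_on S f \<Longrightarrow> smooth_on S (\<lambda>x. frechet_derivative f (at x) v)"
  unfolding smooth_on_def using Ck_on.simps(2) by blast

text \<open>The Gram-Schmidt step, which eliminates one vector, keeps everything smooth.\<close>

lemma smooth_on_coefficients:
  fixes a :: "'i \<Rightarrow> 'a::euclidean_space \<Rightarrow> 'b::euclidean_space"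
  assumes "finite I" "open S" "\<And>i. i \<in> I \<Longrightarrow> smooth_on S (a i)" "smooth_on S b"
    and "\<And>y. y \<in> S \<Longrightarrow> b y = (\<Sum>i\<in>I. x i y *\<^sub>R a i y)"
    and "\<And>y c i. y \<in> S \<Longrightarrow> (\<Sum>i\<in>I. c i *\<^sub>R a i y) = 0 \<Longrightarrow> i \<in> I \<Longrightarrow> c i = 0"
    and "i \<in> I"
  shows "smooth_on S (x i)"
  using assms(1,3-)
proof (induction I arbitrary: a b i rule: finite_induct)
  case (insert j I)
  define n where "n y = a j y \<bullet> a j y" for y
  define a' where "a' i y = a i y - (a i y \<bullet> a j y / n y) *\<^sub>R a j y" for i y
  define b' where "b' y = b y - (b y \<bullet> a j y / n y) *\<^sub>R a j y" for y
  have n0: "n y \<noteq> 0" if "y \<in> S" for y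
  proof
    assume "n y = 0"
    then have "(\<Sum>i\<in>insert j I. (if i = j then 1 else 0) *\<^sub>R a i y) = 0"
      by (auto simp: n_def if_distrib[of "\<lambda>c. c *\<^sub>R _"] insert.hyps cong: if_cong)
    from insert.prems(4)[OF that this, of j] show False by simp
  qed
  have sn: "smooth_on S n"
    unfolding n_def using insert.prems(1) by (intro smooth_on_inner \<open>open S\<close>) auto
  have proj: "smooth_on S (\<lambda>y. c y - (c y \<bullet> a j y / n y) *\<^sub>R a j y)" if "smooth_on S c" for c
    using insert.prems(1) that sn n0
    by (intro smooth_on_diff smooth_on_scaleR smooth_on_divide smooth_on_inner \<open>open S\<close>) auto
  have x: "smooth_on S (x i)" if "i \<in> I" for i
  proof (rule insert.IH[of a' b' i])
    show "smooth_on S (a' i)" if "i \<in> I" for i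
      unfolding a'_def using proj insert.prems(1) that by blast
    show "smooth_on S b'"
      unfolding b'_def using proj insert.prems(2) by blast
    show "b' y = (\<Sum>i\<in>I. x i y *\<^sub>R a' i y)" if y: "y \<in> S" for y
    proof -
      have b: "b y = x j y *\<^sub>R a j y + (\<Sum>i\<in>I. x i y *\<^sub>R a i y)"
        using insert.prems(3)[OF y] insert.hyps by simp
      have "b y \<bullet> a j y / n y = x j y + (\<Sum>i\<in>I. x i y * (a i y \<bullet> a j y / n y))"
        using n0[OF y] unfolding b
        by (simp add: inner_add_left inner_sum_left add_divide_distrib sum_divide_distrib flip: n_def)
      then show ?thesis
        unfolding b'_def a'_def
        by (simp add: b algebra_simps scaleR_sum_left sum_subtractf)
    qed
    show "c i = 0" if y: "y \<in> S" and s: "(\<Sum>i\<in>I. c i *\<^sub>R a' i y) = 0" and i: "i \<in> I" for y c i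
    proof -
      define c' where "c' i = (if i = j then - (\<Sum>i\<in>I. c i * (a i y \<bullet> a j y / n y)) else c i)" for i
      have "(\<Sum>i\<in>insert j I. c' i *\<^sub>R a i y) = (\<Sum>i\<in>I. c i *\<^sub>R a' i y)"
      proof -
        have "(\<Sum>i\<in>I. c' i *\<^sub>R a i y) = (\<Sum>i\<in>I. c i *\<^sub>R a i y)"
          using insert.hyps by (intro sum.cong) (auto simp: c'_def)
        then show ?thesis
          using insert.hyps
          by (simp add: a'_def c'_def algebra_simps scaleR_sum_left sum_subtractf)
      qed
      then have "c' i = 0" using insert.prems(4)[OF y, of c' i] s i by simp
      then show ?thesis using i insert.hyps by (auto simp: c'_def split: if_splits)
    qed
    show "i \<in> I" by fact
  qed
  have "smooth_on S (x j)"
  proof (rule smooth_on_cong[OF \<open>open S\<close>])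
    show "smooth_on S (\<lambda>y. ((b y - (\<Sum>i\<in>I. x i y *\<^sub>R a i y)) \<bullet> a j y) / n y)"
      using insert.prems(1,2) x sn n0
      by (intro smooth_on_diff smooth_on_scaleR smooth_on_divide smooth_on_inner smooth_on_sum \<open>open S\<close>) auto
    show "((b y - (\<Sum>i\<in>I. x i y *\<^sub>R a i y)) \<bullet> a j y) / n y = x j y" if y: "y \<in> S" for y
      using insert.prems(3)[OF y] n0[OF y] insert.hyps by (simp flip: n_def)
  qed
  with x insert.prems(5) show ?case by auto
qed auto

section \<open>Tangent vectors as derivations\<close>

text \<open>The part of \<open>smooth_manifold\<close> that is used; unlike second countability it passes to
  products without further work.\<close>

locale charted =
  fixes M :: "('a, 'e::euclidean_space) manifold"
  assumes chart_openin: "(U, \<phi>) \<in> atlas M \<Longrightarrow> openin (mtop M) U"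
    and chart_inj: "(U, \<phi>) \<in> atlas M \<Longrightarrow> inj_on \<phi> U"
    and chart_image_open: "(U, \<phi>) \<in> atlas M \<Longrightarrow> openin (mtop M) W \<Longrightarrow> open (\<phi> ` (W \<inter> U))"
    and chart_transition: "(U, \<phi>) \<in> atlas M \<Longrightarrow> (V, \<psi>) \<in> atlas M \<Longrightarrow>
      smooth_on (\<phi> ` (U \<inter> V)) (\<psi> \<circ> inv_into U \<phi>)"
    and ex_chart: "p \<in> points M \<Longrightarrow> \<exists>U \<phi>. (U, \<phi>) \<in> atlas M \<and> p \<in> U"

lemma smooth_manifold_imp_charted:
  assumes "smooth_manifold M"
  shows "charted M"
proof
  fix U :: "'a set" and \<phi> :: "'a \<Rightarrow> 'b"
  assume c: "(U, \<phi>) \<in> atlas M"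
  show U: "openin (mtop M) U"
    using assms c by (auto simp: smooth_manifold_def)
  have o: "open (\<phi> ` U)"
    and h: "homeomorphic_map (subtopology (mtop M) U) (top_of_set (\<phi> ` U)) \<phi>"
    using assms c by (auto simp: smooth_manifold_def)
  have "topspace (subtopology (mtop M) U) = U"
    using U openin_subset by fastforce
  then show "inj_on \<phi> U"
    using homeomorphic_imp_injective_map[OF h] by simp
  show "open (\<phi> ` (W \<inter> U))" if "openin (mtop M) W" for W
  proof -
    have "openin (top_of_set (\<phi> ` U)) (\<phi> ` (W \<inter> U))"
      using homeomorphic_imp_open_map[OF h] openin_subtopology_Int[OF that, of U]
      unfolding open_map_def by blast
    then show ?thesis using o openin_open_trans by blast
  qed
  show "smooth_on (\<phi> ` (U \<inter> V)) (\<psi> \<circ> inv_into U \<phi>)" if "(V, \<psi>) \<in> atlas M" for V \<psi>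
    using assms c that by (fastforce simp: smooth_manifold_def)
next
  fix p assume "p \<in> points M"
  then have "p \<in> (\<Union>(U, \<phi>)\<in>atlas M. U)"
    using assms by (simp add: smooth_manifold_def)
  then show "\<exists>U \<phi>. (U, \<phi>) \<in> atlas M \<and> p \<in> U" by auto
qed

definition coordinate_vector ::
    "('a, 'e::euclidean_space) manifold \<Rightarrow> 'a set \<Rightarrow> ('a \<Rightarrow> 'e) \<Rightarrow> 'a \<Rightarrow> 'e \<Rightarrow> 'a tangent_vector" where
  "coordinate_vector M U \<phi> p v =
     (\<lambda>f. if f \<in> smooth_near M p then frechet_derivative (f \<circ> inv_into U \<phi>) (at (\<phi> p)) v else 0)"

lemma tangent_space_eq:
  "tangent_space M p = {coordinate_vector M U \<phi> p v | U \<phi> v. (U, \<phi>) \<in> atlas M \<and> p \<in> U}"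
  by (simp add: tangent_space_def coordinate_vector_def)

lemma tangent_vector_not_smooth_near: "v \<in> tangent_space M p \<Longrightarrow> f \<notin> smooth_near M p \<Longrightarrow> v f = 0"
  by (auto simp: tangent_space_def)

lemma smooth_fun_onD:
  "smooth_fun_on M W f \<Longrightarrow> (U, \<phi>) \<in> atlas M \<Longrightarrow> smooth_on (\<phi> ` (W \<inter> U)) (f \<circ> inv_into U \<phi>)"
  by (auto simp: smooth_fun_on_def)

lemma smooth_fun_on_openin: "smooth_fun_on M W f \<Longrightarrow> openin (mtop M) W"
  by (simp add: smooth_fun_on_def)

lemma smooth_near_points: "f \<in> smooth_near M p \<Longrightarrow> p \<in> points M"
  unfolding smooth_near_def using smooth_fun_on_openin openin_subset by blast

context charted
begin

lemma smooth_fun_onI: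
  "openin (mtop M) W \<Longrightarrow>
    (\<And>U \<phi>. (U, \<phi>) \<in> atlas M \<Longrightarrow> open (\<phi> ` (W \<inter> U)) \<Longrightarrow> smooth_on (\<phi> ` (W \<inter> U)) (f \<circ> inv_into U \<phi>)) \<Longrightarrow>
    smooth_fun_on M W f"
  using chart_image_open by (auto simp: smooth_fun_on_def)

lemma smooth_fun_on_cong:
  assumes "smooth_fun_on M W f" "\<And>q. q \<in> W \<Longrightarrow> f q = g q"
  shows "smooth_fun_on M W g"
proof (rule smooth_fun_onI)
  fix U \<phi> assume c: "(U, \<phi>) \<in> atlas M" "open (\<phi> ` (W \<inter> U))"
  show "smooth_on (\<phi> ` (W \<inter> U)) (g \<circ> inv_into U \<phi>)"
    by (rule smooth_on_cong[OF c(2) _ smooth_fun_onD[OF assms(1) c(1)]])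
      (use assms(2) chart_inj[OF c(1)] in auto)
qed (use assms in \<open>auto simp: smooth_fun_on_def\<close>)

lemma smooth_fun_on_subset:
  assumes "smooth_fun_on M W f" "openin (mtop M) W'" "W' \<subseteq> W"
  shows "smooth_fun_on M W' f"
proof (rule smooth_fun_onI[OF assms(2)])
  fix U \<phi> assume c: "(U, \<phi>) \<in> atlas M"
  show "smooth_on (\<phi> ` (W' \<inter> U)) (f \<circ> inv_into U \<phi>)"
    by (rule smooth_on_subset[OF smooth_fun_onD[OF assms(1) c]]) (use assms(3) in auto)
qed

lemma smooth_fun_on_const: "openin (mtop M) W \<Longrightarrow> smooth_fun_on M W (\<lambda>q. c)"
  by (rule smooth_fun_onI) (auto simp: o_def)

lemma smooth_fun_on_add:
  assumes "smooth_fun_on M W f" "smooth_fun_on M W g"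
  shows "smooth_fun_on M W (\<lambda>q. f q + g q)"
proof (rule smooth_fun_onI[OF smooth_fun_on_openin[OF assms(1)]])
  fix U \<phi> assume c: "(U, \<phi>) \<in> atlas M" "open (\<phi> ` (W \<inter> U))"
  show "smooth_on (\<phi> ` (W \<inter> U)) ((\<lambda>q. f q + g q) \<circ> inv_into U \<phi>)"
    using smooth_on_add[OF c(2) assms[THEN smooth_fun_onD[OF _ c(1)]]] by (simp add: o_def)
qed

lemma smooth_fun_on_mult:
  assumes "smooth_fun_on M W f" "smooth_fun_on M W g"
  shows "smooth_fun_on M W (\<lambda>q. f q * g q)"
proof (rule smooth_fun_onI[OF smooth_fun_on_openin[OF assms(1)]])
  fix U \<phi> assume c: "(U, \<phi>) \<in> atlas M" "open (\<phi> ` (W \<inter> U))"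
  show "smooth_on (\<phi> ` (W \<inter> U)) ((\<lambda>q. f q * g q) \<circ> inv_into U \<phi>)"
    using smooth_on_mult[OF c(2) assms[THEN smooth_fun_onD[OF _ c(1)]]] by (simp add: o_def)
qed

lemma smooth_fun_on_sum:
  assumes "openin (mtop M) W" "\<And>i. i \<in> I \<Longrightarrow> smooth_fun_on M W (f i)"
  shows "smooth_fun_on M W (\<lambda>q. \<Sum>i\<in>I. f i q)"
  using assms(2) by (induction I rule: infinite_finite_induct)
    (auto intro: smooth_fun_on_const smooth_fun_on_add assms(1))

lemma smooth_near_common:
  assumes "f \<in> smooth_near M p" "g \<in> smooth_near M p"
  obtains W where "p \<in> W" "smooth_fun_on M W f" "smooth_fun_on M W g"
proof -
  obtain U V where "p \<in> U" "smooth_fun_on M U f" "p \<in> V" "smooth_fun_on M V g"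
    using assms by (auto simp: smooth_near_def)
  then show thesis
    by (intro that[of "U \<inter> V"]) (auto intro: smooth_fun_on_subset smooth_fun_on_openin)
qed

lemma smooth_near_add: "f \<in> smooth_near M p \<Longrightarrow> g \<in> smooth_near M p \<Longrightarrow> (\<lambda>q. f q + g q) \<in> smooth_near M p"
  by (erule (1) smooth_near_common) (auto simp: smooth_near_def intro: smooth_fun_on_add)

lemma smooth_near_mult: "f \<in> smooth_near M p \<Longrightarrow> g \<in> smooth_near M p \<Longrightarrow> (\<lambda>q. f q * g q) \<in> smooth_near M p"
  by (erule (1) smooth_near_common) (auto simp: smooth_near_def intro: smooth_fun_on_mult)

lemma smooth_near_const: "p \<in> points M \<Longrightarrow> (\<lambda>q. c) \<in> smooth_near M p"
  using smooth_fun_on_const[of "points M"] by (auto simp: smooth_near_def)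

lemma smooth_near_sum:
  assumes "p \<in> points M" "\<And>i. i \<in> I \<Longrightarrow> f i \<in> smooth_near M p"
  shows "(\<lambda>q. \<Sum>i\<in>I. f i q) \<in> smooth_near M p"
  using assms(2) by (induction I rule: infinite_finite_induct)
    (auto intro: smooth_near_const smooth_near_add assms(1))

lemma smooth_near_cong:
  assumes "f \<in> smooth_near M p" "\<And>q. q \<in> points M \<Longrightarrow> f q = g q"
  shows "g \<in> smooth_near M p"
proof -
  obtain U where "p \<in> U" "smooth_fun_on M U f"
    using assms(1) by (auto simp: smooth_near_def)
  then show ?thesis
    unfolding smooth_near_def using smooth_fun_on_cong[of U f g] assms(2)
      openin_subset[OF smooth_fun_on_openin] by blast
qed

lemma smooth_near_has_derivative:
  assumes "f \<in> smooth_near M p" "(U, \<phi>) \<in> atlas M" "p \<in> U"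
  shows "((f \<circ> inv_into U \<phi>) has_derivative frechet_derivative (f \<circ> inv_into U \<phi>) (at (\<phi> p))) (at (\<phi> p))"
proof -
  obtain W where "p \<in> W" "smooth_fun_on M W f"
    using assms(1) by (auto simp: smooth_near_def)
  then show ?thesis
    using smooth_on_has_derivative[OF smooth_fun_onD[OF _ assms(2)]] assms(3) by blast
qed

lemma coordinate_vector_eqI:
  assumes "f \<in> smooth_near M p" "(f \<circ> inv_into U \<phi> has_derivative f') (at (\<phi> p))"
  shows "coordinate_vector M U \<phi> p v f = f' v"
  using assms by (simp add: coordinate_vector_def flip: frechet_derivative_at)

lemma chart_subset: "(U, \<phi>) \<in> atlas M \<Longrightarrow> U \<subseteq> points M"
  using chart_openin openin_subset by blast

lemma smooth_fun_on_chart: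
  assumes "(U, \<phi>) \<in> atlas M"
  shows "smooth_fun_on M U (\<lambda>q. \<phi> q \<bullet> b)"
proof (rule smooth_fun_onI[OF chart_openin[OF assms]])
  fix V \<psi> assume c: "(V, \<psi>) \<in> atlas M" "open (\<psi> ` (U \<inter> V))"
  have "smooth_on (\<psi> ` (U \<inter> V)) (\<lambda>y. (\<phi> \<circ> inv_into V \<psi>) y \<bullet> b)"
    using chart_transition[OF c(1) assms] 
    by (intro smooth_on_inner[OF c(2)]) (simp_all add: Int_commute comp_def)
  then show "smooth_on (\<psi> ` (U \<inter> V)) ((\<lambda>q. \<phi> q \<bullet> b) \<circ> inv_into V \<psi>)"
    by (simp add: o_def)
qed

lemma smooth_near_chart: "(U, \<phi>) \<in> atlas M \<Longrightarrow> p \<in> U \<Longrightarrow> (\<lambda>q. \<phi> q \<bullet> b) \<in> smooth_near M p"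
  unfolding smooth_near_def using smooth_fun_on_chart by blast

lemma chart_image_openin: "(U, \<phi>) \<in> atlas M \<Longrightarrow> open (\<phi> ` U)"
  using chart_image_open[of U \<phi> U] chart_openin by simp

lemma coordinate_vector_chart:
  assumes "(U, \<phi>) \<in> atlas M" "p \<in> U"
  shows "coordinate_vector M U \<phi> p v (\<lambda>q. \<phi> q \<bullet> b) = v \<bullet> b"
proof (rule coordinate_vector_eqI[OF smooth_near_chart[OF assms]])
  have "((\<lambda>y. y \<bullet> b) has_derivative (\<lambda>v. v \<bullet> b)) (at (\<phi> p))"
    by (intro bounded_linear_imp_has_derivative bounded_linear_inner_left)
  then show "((\<lambda>q. \<phi> q \<bullet> b) \<circ> inv_into U \<phi> has_derivative (\<lambda>v. v \<bullet> b)) (at (\<phi> p))"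
    by (rule has_derivative_transform_within_open[OF _ chart_image_openin[OF assms(1)]])
      (use assms in \<open>auto simp: f_inv_into_f\<close>)
qed

lemma coordinate_vector_sum:
  assumes "(U, \<phi>) \<in> atlas M" "p \<in> U"
  shows "coordinate_vector M U \<phi> p (\<Sum>i\<in>I. c i *\<^sub>R v i) f = (\<Sum>i\<in>I. c i * coordinate_vector M U \<phi> p (v i) f)"
proof (cases "f \<in> smooth_near M p")
  case True
  then have "linear (frechet_derivative (f \<circ> inv_into U \<phi>) (at (\<phi> p)))"
    using smooth_near_has_derivative[OF True assms] has_derivative_linear by blast
  with True show ?thesis
    by (simp add: coordinate_vector_def linear_sum linear_cmul)
qed (simp add: coordinate_vector_def)

lemma tangent_space_chartE:
  assumes "v \<in> tangent_space M p" "(U, \<phi>) \<in> atlas M" "p \<in> U"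
  obtains a where "v = coordinate_vector M U \<phi> p a"
proof -
  obtain V \<psi> w where c: "(V, \<psi>) \<in> atlas M" "p \<in> V" and v: "v = coordinate_vector M V \<psi> p w"
    using assms(1) by (auto simp: tangent_space_eq)
  define t where "t = \<phi> \<circ> inv_into V \<psi>"
  define t' where "t' = frechet_derivative t (at (\<psi> p))"
  have inv: "inv_into V \<psi> (\<psi> q) = q" if "q \<in> V" for q
    using chart_inj[OF c(1)] that by simp
  have t: "(t has_derivative t') (at (\<psi> p))"
    unfolding t_def t'_def using smooth_on_has_derivative[OF chart_transition[OF c(1) assms(2)]] c assms by blast
  have tp: "t (\<psi> p) = \<phi> p"
    using c inv by (simp add: t_def)
  have "v f = coordinate_vector M U \<phi> p (t' w) f" for f
  proof (cases "f \<in> smooth_near M p")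
    case True
    define F where "F = f \<circ> inv_into U \<phi>"
    have F: "(F has_derivative frechet_derivative F (at (\<phi> p))) (at (t (\<psi> p)))"
      unfolding F_def tp by (rule smooth_near_has_derivative[OF True assms(2,3)])
    have "((f \<circ> inv_into V \<psi>) has_derivative (\<lambda>w. frechet_derivative F (at (\<phi> p)) (t' w))) (at (\<psi> p))"
    proof (rule has_derivative_transform_within_open[OF has_derivative_compose[OF t F]])
      show "open (\<psi> ` (U \<inter> V))" using chart_image_open[OF c(1) chart_openin[OF assms(2)]] .
      show "\<psi> p \<in> \<psi> ` (U \<inter> V)" using assms c by auto
      show "F (t y) = (f \<circ> inv_into V \<psi>) y" if "y \<in> \<psi> ` (U \<inter> V)" for y
        using that inv chart_inj[OF assms(2)] by (auto simp: F_def t_def)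
    qed
    then show ?thesis
      unfolding v by (simp only: coordinate_vector_eqI[OF True]) (simp only: coordinate_vector_def True F_def if_True)
  qed (simp add: v coordinate_vector_def)
  then show thesis using that by blast
qed

lemma tangent_vector_chart_expansion:
  assumes "v \<in> tangent_space M p" "(U, \<phi>) \<in> atlas M" "p \<in> U"
  shows "v = coordinate_vector M U \<phi> p (\<Sum>b\<in>Basis. v (\<lambda>q. \<phi> q \<bullet> b) *\<^sub>R b)"
proof -
  obtain a where a: "v = coordinate_vector M U \<phi> p a"
    using tangent_space_chartE[OF assms] .
  show ?thesis
    unfolding a by (simp add: coordinate_vector_chart[OF assms(2,3)] euclidean_representation)
qed

lemma tangent_space_eqI:
  assumes "v \<in> tangent_space M p" "w \<in> tangent_space M p" "(U, \<phi>) \<in> atlas M" "p \<in> U"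
    and "\<And>b. b \<in> Basis \<Longrightarrow> v (\<lambda>q. \<phi> q \<bullet> b) = w (\<lambda>q. \<phi> q \<bullet> b)"
  shows "v = w"
proof -
  obtain a a' where a: "v = coordinate_vector M U \<phi> p a" "w = coordinate_vector M U \<phi> p a'"
    using tangent_space_chartE[OF assms(1,3,4)] tangent_space_chartE[OF assms(2-4)] by metis
  then have "a = a'"
    using assms(5) by (auto intro!: euclidean_eqI[of a a'] simp: coordinate_vector_chart[OF assms(3,4)])
  then show ?thesis using a by simp
qed

lemma tangent_space_sum:
  assumes "p \<in> points M" "\<And>i. i \<in> I \<Longrightarrow> v i \<in> tangent_space M p"
  shows "(\<lambda>f. \<Sum>i\<in>I. c i * v i f) \<in> tangent_space M p"
proof -
  obtain U \<phi> where c: "(U, \<phi>) \<in> atlas M" "p \<in> U"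
    using ex_chart[OF assms(1)] by blast
  have "\<forall>i\<in>I. \<exists>a. v i = coordinate_vector M U \<phi> p a"
    using tangent_space_chartE[OF assms(2) c] by metis
  then obtain a where "\<And>i. i \<in> I \<Longrightarrow> v i = coordinate_vector M U \<phi> p (a i)"
    by metis
  then have "(\<lambda>f. \<Sum>i\<in>I. c i * v i f) = coordinate_vector M U \<phi> p (\<Sum>i\<in>I. c i *\<^sub>R a i)"
    by (auto simp: coordinate_vector_sum[OF c])
  then show ?thesis using c by (auto simp: tangent_space_eq)
qed

lemma tangent_space_zero: "p \<in> points M \<Longrightarrow> (\<lambda>f. 0) \<in> tangent_space M p"
  using tangent_space_sum[of p "{}" "\<lambda>_ _. 0"] by simp

lemma tangent_vector_derivative:
  assumes "v \<in> tangent_space M p"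
  obtains U \<phi> a where "(U, \<phi>) \<in> atlas M" "p \<in> U"
    "\<And>f. f \<in> smooth_near M p \<Longrightarrow> \<exists>f'. (f \<circ> inv_into U \<phi> has_derivative f') (at (\<phi> p)) \<and> v f = f' a"
    "\<And>f f'. f \<in> smooth_near M p \<Longrightarrow> (f \<circ> inv_into U \<phi> has_derivative f') (at (\<phi> p)) \<Longrightarrow> v f = f' a"
proof -
  obtain U \<phi> a where c: "(U, \<phi>) \<in> atlas M" "p \<in> U" and v: "v = coordinate_vector M U \<phi> p a"
    using assms by (auto simp: tangent_space_eq)
  then show thesis
    by (intro that[OF c, of a]) (auto intro: coordinate_vector_eqI smooth_near_has_derivative)
qed

lemma tangent_vector_cong:
  assumes "v \<in> tangent_space M p" "\<And>q. q \<in> points M \<Longrightarrow> f q = g q"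
  shows "v f = v g"
proof (cases "f \<in> smooth_near M p")
  case True
  then have g: "g \<in> smooth_near M p" using smooth_near_cong assms(2) by blast
  from assms(1) show ?thesis
  proof (rule tangent_vector_derivative)
    fix U \<phi> a
    assume c: "(U, \<phi>) \<in> atlas M" "p \<in> U"
      and 1: "\<And>f. f \<in> smooth_near M p \<Longrightarrow> \<exists>f'. (f \<circ> inv_into U \<phi> has_derivative f') (at (\<phi> p)) \<and> v f = f' a"
      and 2: "\<And>f f'. f \<in> smooth_near M p \<Longrightarrow> (f \<circ> inv_into U \<phi> has_derivative f') (at (\<phi> p)) \<Longrightarrow> v f = f' a"
    obtain f' where f': "(f \<circ> inv_into U \<phi> has_derivative f') (at (\<phi> p))" "v f = f' a"
      using 1[OF True] by blast
    have "(g \<circ> inv_into U \<phi> has_derivative f') (at (\<phi> p))"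
      by (rule has_derivative_transform_within_open[OF f'(1) chart_image_openin[OF c(1)]])
        (use c assms(2) chart_subset[OF c(1)] inv_into_into[of _ \<phi> U] in auto)
    then show ?thesis using 2[OF g] f'(2) by simp
  qed
next
  case False
  then have "g \<notin> smooth_near M p" using smooth_near_cong[of g p f] assms(2) by auto
  with False show ?thesis using tangent_vector_not_smooth_near[OF assms(1)] by simp
qed

lemma tangent_vector_add:
  assumes "v \<in> tangent_space M p" "f \<in> smooth_near M p" "g \<in> smooth_near M p"
  shows "v (\<lambda>q. f q + g q) = v f + v g"
  using assms(1)
proof (rule tangent_vector_derivative)
  fix U \<phi> a
  assume c: "(U, \<phi>) \<in> atlas M" "p \<in> U"
    and 1: "\<And>f. f \<in> smooth_near M p \<Longrightarrow> \<exists>f'. (f \<circ> inv_into U \<phi> has_derivative f') (at (\<phi> p)) \<and> v f = f' a"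
    and 2: "\<And>f f'. f \<in> smooth_near M p \<Longrightarrow> (f \<circ> inv_into U \<phi> has_derivative f') (at (\<phi> p)) \<Longrightarrow> v f = f' a"
  obtain f' g' where d: "(f \<circ> inv_into U \<phi> has_derivative f') (at (\<phi> p))" "v f = f' a"
    "(g \<circ> inv_into U \<phi> has_derivative g') (at (\<phi> p))" "v g = g' a"
    using 1 assms by blast
  show ?thesis
    using 2[OF smooth_near_add[OF assms(2,3)], of "\<lambda>v. f' v + g' v"] has_derivative_add[OF d(1,3)] d(2,4)
    by (simp add: o_def)
qed

lemma tangent_vector_mult:
  assumes "v \<in> tangent_space M p" "f \<in> smooth_near M p" "g \<in> smooth_near M p"
  shows "v (\<lambda>q. f q * g q) = f p * v g + v f * g p"
  using assms(1)
proof (rule tangent_vector_derivative)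
  fix U \<phi> a
  assume c: "(U, \<phi>) \<in> atlas M" "p \<in> U"
    and 1: "\<And>f. f \<in> smooth_near M p \<Longrightarrow> \<exists>f'. (f \<circ> inv_into U \<phi> has_derivative f') (at (\<phi> p)) \<and> v f = f' a"
    and 2: "\<And>f f'. f \<in> smooth_near M p \<Longrightarrow> (f \<circ> inv_into U \<phi> has_derivative f') (at (\<phi> p)) \<Longrightarrow> v f = f' a"
  obtain f' g' where d: "(f \<circ> inv_into U \<phi> has_derivative f') (at (\<phi> p))" "v f = f' a"
    "(g \<circ> inv_into U \<phi> has_derivative g') (at (\<phi> p))" "v g = g' a"
    using 1 assms by blast
  have "inv_into U \<phi> (\<phi> p) = p" using chart_inj[OF c(1)] c(2) by simp
  then show ?thesis
    using 2[OF smooth_near_mult[OF assms(2,3)], of "\<lambda>v. f p * g' v + f' v * g p"]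
      has_derivative_mult[OF d(1,3)] d(2,4)
    by (simp add: o_def)
qed

lemma tangent_vector_const:
  assumes "v \<in> tangent_space M p"
  shows "v (\<lambda>q. c) = 0"
  using assms
proof (rule tangent_vector_derivative)
  fix U \<phi> a
  assume c: "(U, \<phi>) \<in> atlas M" "p \<in> U"
    and 2: "\<And>f f'. f \<in> smooth_near M p \<Longrightarrow> (f \<circ> inv_into U \<phi> has_derivative f') (at (\<phi> p)) \<Longrightarrow> v f = f' a"
  show ?thesis
    using 2[OF smooth_near_const, of c "\<lambda>_. 0"] c chart_subset by (auto simp: o_def)
qed

lemma tangent_vector_sum:
  assumes "v \<in> tangent_space M p" "p \<in> points M" "\<And>i. i \<in> I \<Longrightarrow> f i \<in> smooth_near M p"
  shows "v (\<lambda>q. \<Sum>i\<in>I. f i q) = (\<Sum>i\<in>I. v (f i))"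
  using assms(3)
proof (induction I rule: infinite_finite_induct)
  case (insert i I)
  then show ?case
    using tangent_vector_add[OF assms(1), of "f i" "\<lambda>q. \<Sum>i\<in>I. f i q"] smooth_near_sum[OF assms(2), of I f] by simp
qed (auto simp: tangent_vector_const[OF assms(1)])

lemma vector_field_smooth_near:
  assumes "X \<in> vector_fields M" "f \<in> smooth_near M p"
  shows "(\<lambda>q. X q f) \<in> smooth_near M p"
  using assms unfolding vector_fields_def smooth_near_def by blast

lemma vector_field_tangent: "X \<in> vector_fields M \<Longrightarrow> p \<in> points M \<Longrightarrow> X p \<in> tangent_space M p"
  unfolding vector_fields_def by blast

lemma vector_field_outside: "X \<in> vector_fields M \<Longrightarrow> p \<notin> points M \<Longrightarrow> X p f = 0"
  unfolding vector_fields_def by auto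

lemma vector_fields_sum:
  assumes "\<And>i. i \<in> I \<Longrightarrow> X i \<in> vector_fields M"
  shows "(\<lambda>p f. \<Sum>i\<in>I. c i * X i p f) \<in> vector_fields M"
proof -
  have "smooth_fun_on M U (\<lambda>p. \<Sum>i\<in>I. c i * X i p f)" if "smooth_fun_on M U f" for U f
    using that assms smooth_fun_on_openin[OF that]
    by (intro smooth_fun_on_sum smooth_fun_on_mult smooth_fun_on_const) (auto simp: vector_fields_def)
  moreover have "(\<lambda>f. \<Sum>i\<in>I. c i * X i p f) \<in> tangent_space M p" if "p \<in> points M" for p
    by (rule tangent_space_sum[OF that vector_field_tangent[OF assms that]])
  moreover have "(\<lambda>f. \<Sum>i\<in>I. c i * X i p f) = (\<lambda>f. 0)" if "p \<notin> points M" for p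
    using vector_field_outside[OF assms that] by (simp add: fun_eq_iff)
  ultimately show ?thesis
    unfolding vector_fields_def by blast
qed

lemma zero_field: "(\<lambda>p f. 0) \<in> vector_fields M"
  using vector_fields_sum[of "{}" "\<lambda>_ _ _. 0"] by simp

lemma coordinate_vector_zero:
  assumes "(U, \<phi>) \<in> atlas M" "p \<in> U"
  shows "coordinate_vector M U \<phi> p 0 = (\<lambda>f. 0)"
  using coordinate_vector_sum[OF assms, where I = "{}"] by auto

lemma lie_bracket_zero:
  assumes "X \<in> vector_fields M" "p \<in> points M"
  shows "lie_bracket M X (\<lambda>p f. 0) p f = 0" "lie_bracket M (\<lambda>p f. 0) X p f = 0"
  using tangent_vector_const[OF vector_field_tangent[OF assms], of 0] by (simp_all add: lie_bracket_def)

end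

section \<open>The Levi-Civita connection in a global orthonormal frame\<close>

definition polarization :: "((nat \<Rightarrow> real) \<Rightarrow> real) \<Rightarrow> (nat \<Rightarrow> real) \<Rightarrow> (nat \<Rightarrow> real) \<Rightarrow> (nat \<Rightarrow> real) \<Rightarrow> real" where
  "polarization C a b c = (C (\<lambda>i. a i + b i + c i) - C (\<lambda>i. a i + b i) - C (\<lambda>i. a i + c i) - C (\<lambda>i. b i + c i)
     + C a + C b + C c) / 6"

locale framed = charted M for M :: "('a, 'e::euclidean_space) manifold" +
  fixes I :: "nat set" and E :: "nat \<Rightarrow> 'a vector_field"
  assumes finite_index: "finite I"
    and frame_field: "i \<in> I \<Longrightarrow> E i \<in> vector_fields M"
    and frame_independent: "p \<in> points M \<Longrightarrow> (\<And>f. (\<Sum>i\<in>I. c i * E i p f) = 0) \<Longrightarrow> i \<in> I \<Longrightarrow> c i = 0"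
    and frame_spans: "v \<in> tangent_space M p \<Longrightarrow> p \<in> points M \<Longrightarrow> \<exists>c. v = (\<lambda>f. \<Sum>i\<in>I. c i * E i p f)"
begin

abbreviation comb :: "(nat \<Rightarrow> real) \<Rightarrow> 'a vector_field" where
  "comb x \<equiv> (\<lambda>p f. \<Sum>i\<in>I. x i * E i p f)"

lemma comb_field: "comb x \<in> vector_fields M"
  using frame_field by (rule vector_fields_sum)

lemma comb_tangent: "p \<in> points M \<Longrightarrow> comb x p \<in> tangent_space M p"
  using comb_field vector_field_tangent by blast

lemma frame_tangent: "p \<in> points M \<Longrightarrow> i \<in> I \<Longrightarrow> E i p \<in> tangent_space M p"
  using frame_field vector_field_tangent by blast

lemma comb_delta: "i \<in> I \<Longrightarrow> comb (\<lambda>j. if j = i then 1 else 0) = E i"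
  using finite_index by (simp add: fun_eq_iff if_distrib[of "\<lambda>c. c * _"] cong: if_cong)

lemma comb_delta_at: "i \<in> I \<Longrightarrow> comb (\<lambda>j. if j = i then 1 else 0) p = E i p"
  using fun_cong[OF comb_delta] by simp

lemma comb_inject:
  assumes "p \<in> points M" "comb x p = comb y p" "i \<in> I"
  shows "x i = y i"
proof -
  have "(\<Sum>i\<in>I. (x i - y i) * E i p f) = 0" for f
    using fun_cong[OF assms(2), of f] by (simp add: left_diff_distrib sum_subtractf)
  from frame_independent[OF assms(1) this assms(3)] show ?thesis by simp
qed

lemma frame_coord_comb:
  assumes "p \<in> points M"
  shows "frame_coord I E p (comb x p) = restrict x I"
  unfolding frame_coord_def
proof (rule the_equality)
  show "restrict x I \<in> extensional I \<and> comb x p = comb (restrict x I) p"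
    by simp
next
  fix y assume y: "y \<in> extensional I \<and> comb x p = comb y p"
  show "y = restrict x I"
    by (rule extensionalityI[of _ I]) (use y comb_inject[OF assms, of x y] in auto)
qed

lemma frame_expansion:
  assumes "v \<in> tangent_space M p" "p \<in> points M"
  shows "v = comb (frame_coord I E p v) p"
proof -
  obtain c where c: "v = comb c p"
    using frame_spans[OF assms] by blast
  show ?thesis unfolding c frame_coord_comb[OF assms(2)] by simp
qed

lemma frame_coord_frame:
  "p \<in> points M \<Longrightarrow> i \<in> I \<Longrightarrow> j \<in> I \<Longrightarrow> frame_coord I E p (E i p) j = (if j = i then 1 else 0)"
  using frame_coord_comb[of p "\<lambda>j. if j = i then 1 else 0"] by (simp add: comb_delta_at)

lemma frame_metric_frame:
  assumes "p \<in> points M" "i \<in> I"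
  shows "frame_metric I E p v (E i p) = frame_coord I E p v i"
  using assms finite_index
  by (simp add: frame_metric_def frame_coord_frame if_distrib[of "\<lambda>c. _ * c"] cong: sum.cong if_cong)

lemma field_expansion:
  assumes "X \<in> vector_fields M"
  shows "X q f = (\<Sum>i\<in>I. frame_coord I E q (X q) i * E i q f)"
proof (cases "q \<in> points M")
  case True
  then show ?thesis using frame_expansion[OF vector_field_tangent[OF assms True] True] by metis
next
  case False
  then show ?thesis using vector_field_outside[OF assms] vector_field_outside[OF frame_field] by simp
qed

lemma smooth_fun_on_frame_coord:
  assumes X: "X \<in> vector_fields M" and i: "i \<in> I"
  shows "smooth_fun_on M (points M) (\<lambda>q. frame_coord I E q (X q) i)"
proof (rule smooth_fun_onI)
  fix U \<phi> assume c: "(U, \<phi>) \<in> atlas M" and o: "open (\<phi> ` (points M \<inter> U))"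
  have U: "points M \<inter> U = U" "U \<inter> U = U" using chart_subset[OF c] by auto
  define r where "r Y y = (\<Sum>b\<in>Basis. Y (inv_into U \<phi> y) (\<lambda>q. \<phi> q \<bullet> b) *\<^sub>R b)" for Y :: "'a vector_field" and y
  have inv: "inv_into U \<phi> (\<phi> q) = q" if "q \<in> U" for q
    using chart_inj[OF c] that by simp
  have r: "smooth_on (\<phi> ` U) (r Y)" if "Y \<in> vector_fields M" for Y
  proof -
    have "smooth_fun_on M U (\<lambda>q. Y q (\<lambda>q. \<phi> q \<bullet> b))" for b
      using that smooth_fun_on_chart[OF c] unfolding vector_fields_def by blast
    from smooth_fun_onD[OF this c] have "smooth_on (\<phi> ` U) (\<lambda>y. Y (inv_into U \<phi> y) (\<lambda>q. \<phi> q \<bullet> b))" for b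
      by (simp add: o_def)
    then show ?thesis
      unfolding r_def[abs_def]
      by (intro smooth_on_sum smooth_on_scaleR smooth_on_const chart_image_openin[OF c])
  qed
  have r_comb: "r Y y = (\<Sum>i\<in>I. x i *\<^sub>R r (E i) y)"
    if "\<And>f. Y (inv_into U \<phi> y) f = comb x (inv_into U \<phi> y) f" for Y x y
    unfolding r_def that
    by (simp add: scaleR_sum_left scaleR_sum_right) (rule sum.swap)
  show "smooth_on (\<phi> ` (points M \<inter> U)) ((\<lambda>q. frame_coord I E q (X q) i) \<circ> inv_into U \<phi>)"
    unfolding o_def U
  proof (rule smooth_on_coefficients[OF finite_index chart_image_openin[OF c] r[OF frame_field] r[OF X] _ _ i])
    show "r X y = (\<Sum>i\<in>I. frame_coord I E (inv_into U \<phi> y) (X (inv_into U \<phi> y)) i *\<^sub>R r (E i) y)" for y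
      by (rule r_comb) (rule field_expansion[OF X])
    show "x j = 0" if y: "y \<in> \<phi> ` U" and s: "(\<Sum>i\<in>I. x i *\<^sub>R r (E i) y) = 0" and j: "j \<in> I" for y x j
    proof -
      obtain q where q: "q \<in> U" "y = \<phi> q" using y by blast
      have p: "q \<in> points M" using q U by auto
      have "r (comb x) y = 0" using s r_comb[of "comb x" y x] by simp
      then have *: "(\<Sum>b\<in>Basis. comb x q (\<lambda>q. \<phi> q \<bullet> b) *\<^sub>R b) = 0"
        unfolding r_def q(2) inv[OF q(1)] .
      have "comb x q (\<lambda>q. \<phi> q \<bullet> b) = 0" if "b \<in> Basis" for b
        using arg_cong[OF *, of "\<lambda>v. v \<bullet> b"] that by simp
      then have "comb x q = (\<lambda>f. 0)"
        by (intro tangent_space_eqI[OF comb_tangent tangent_space_zero c q(1)]) (use p in auto)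
      then show ?thesis using frame_independent[OF p _ j, of x] by metis
    qed
  qed
qed auto

lemma smooth_near_frame_coord:
  "X \<in> vector_fields M \<Longrightarrow> i \<in> I \<Longrightarrow> p \<in> points M \<Longrightarrow> (\<lambda>q. frame_coord I E q (X q) i) \<in> smooth_near M p"
  unfolding smooth_near_def using smooth_fun_on_frame_coord by blast

context
  fixes D c
  assumes LC: "levi_civita M (frame_metric I E) D"
    and bracket: "\<And>p i j. p \<in> points M \<Longrightarrow> i \<in> I \<Longrightarrow> j \<in> I \<Longrightarrow> lie_bracket M (E i) (E j) p = comb (c p i j) p"
begin

lemma D_field: "X \<in> vector_fields M \<Longrightarrow> Y \<in> vector_fields M \<Longrightarrow> D X Y \<in> vector_fields M"
  using LC by (simp add: levi_civita_def affine_connection_def)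

lemma lie_bracket_frame:
  assumes X: "X \<in> vector_fields M" and p: "p \<in> points M" and k: "k \<in> I"
  shows "lie_bracket M X (E k) p = comb (\<lambda>j. (\<Sum>i\<in>I. frame_coord I E p (X p) i * c p i k j)
     - E k p (\<lambda>q. frame_coord I E q (X q) j)) p"
proof
  fix f
  define x where "x i q = frame_coord I E q (X q) i" for i q
  show "lie_bracket M X (E k) p f = comb (\<lambda>j. (\<Sum>i\<in>I. frame_coord I E p (X p) i * c p i k j)
     - E k p (\<lambda>q. frame_coord I E q (X q) j)) p f"
  proof (cases "f \<in> smooth_near M p")
    case True
    have xs: "x i \<in> smooth_near M p" if "i \<in> I" for i
      unfolding x_def using smooth_near_frame_coord[OF X that p] by simp
    have Es: "(\<lambda>q. E i q f) \<in> smooth_near M p" if "i \<in> I" for i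
      using vector_field_smooth_near[OF frame_field[OF that] True] .
    have Ek: "E k p \<in> tangent_space M p" using frame_tangent p k by blast
    have "E k p (\<lambda>q. X q f) = E k p (\<lambda>q. \<Sum>i\<in>I. x i q * E i q f)"
      unfolding x_def by (simp add: field_expansion[OF X, of _ f])
    also have "\<dots> = (\<Sum>i\<in>I. E k p (\<lambda>q. x i q * E i q f))"
      by (rule tangent_vector_sum[OF Ek p]) (rule smooth_near_mult[OF xs Es])
    also have "\<dots> = (\<Sum>i\<in>I. x i p * E k p (\<lambda>q. E i q f) + E k p (x i) * E i p f)"
      by (rule sum.cong[OF refl]) (rule tangent_vector_mult[OF Ek xs Es])
    finally have 1: "E k p (\<lambda>q. X q f) = \<dots>" .
    have 2: "X p (\<lambda>q. E k q f) = (\<Sum>i\<in>I. x i p * E i p (\<lambda>q. E k q f))"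
      unfolding x_def by (rule field_expansion[OF X])
    have 3: "E i p (\<lambda>q. E k q f) - E k p (\<lambda>q. E i q f) = (\<Sum>j\<in>I. c p i k j * E j p f)" if "i \<in> I" for i
      using fun_cong[OF bracket[OF p that k], of f] True by (simp add: lie_bracket_def)
    have "lie_bracket M X (E k) p f = (\<Sum>i\<in>I. x i p * (E i p (\<lambda>q. E k q f) - E k p (\<lambda>q. E i q f)))
        - (\<Sum>i\<in>I. E k p (x i) * E i p f)"
      using True by (simp add: lie_bracket_def 1 2 right_diff_distrib sum_subtractf sum.distrib)
    also have "(\<Sum>i\<in>I. x i p * (E i p (\<lambda>q. E k q f) - E k p (\<lambda>q. E i q f)))
        = (\<Sum>i\<in>I. x i p * (\<Sum>j\<in>I. c p i k j * E j p f))"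
      by (rule sum.cong) (simp_all add: 3)
    also have "\<dots> = (\<Sum>j\<in>I. (\<Sum>i\<in>I. x i p * c p i k j) * E j p f)"
      by (simp add: sum_distrib_left sum_distrib_right mult.assoc) (rule sum.swap)
    finally show ?thesis
      by (simp add: x_def left_diff_distrib sum_subtractf)
  next
    case False
    then show ?thesis
      using tangent_vector_not_smooth_near[OF frame_tangent[OF p]] by (simp add: lie_bracket_def)
  qed
qed

text \<open>Koszul's formula for \<open>\<nabla>\<^sub>X X\<close>: torsion-freeness turns \<open>g(X, \<nabla>\<^sub>X E\<^sub>k)\<close> into
  \<open>g(X, [X, E\<^sub>k])\<close> plus half the derivative of \<open>g(X, X)\<close> along \<open>E\<^sub>k\<close>, and the derivatives of the
  coefficients of \<open>X\<close> along \<open>E\<^sub>k\<close> cancel.\<close>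

lemma frame_coord_geodesic:
  assumes X: "X \<in> vector_fields M" and p: "p \<in> points M" and k: "k \<in> I"
  shows "frame_coord I E p (D X X p) k = X p (\<lambda>q. frame_coord I E q (X q) k)
    - (\<Sum>i\<in>I. \<Sum>j\<in>I. c p i k j * frame_coord I E p (X p) i * frame_coord I E p (X p) j)"
proof -
  define x where "x i q = frame_coord I E q (X q) i" for i q
  note Ek = frame_field[OF k]
  have metric: "Y p (\<lambda>q. frame_metric I E q (Z q) (W q))
      = frame_metric I E p (D Y Z p) (W p) + frame_metric I E p (Z p) (D Y W p)"
    if "Y \<in> vector_fields M" "Z \<in> vector_fields M" "W \<in> vector_fields M" for Y Z W
    using LC that p by (simp add: levi_civita_def)
  have xs: "x i \<in> smooth_near M p" if "i \<in> I" for i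
    unfolding x_def using smooth_near_frame_coord[OF X that p] by simp
  have m1: "X p (x k) = frame_coord I E p (D X X p) k + frame_metric I E p (X p) (D X (E k) p)"
  proof -
    have "X p (x k) = X p (\<lambda>q. frame_metric I E q (X q) (E k q))"
      by (rule tangent_vector_cong[OF vector_field_tangent[OF X p]])
        (simp add: x_def frame_metric_frame k)
    then show ?thesis unfolding metric[OF X X Ek] frame_metric_frame[OF p k] .
  qed
  have m2: "(\<Sum>i\<in>I. x i p * E k p (x i)) = frame_metric I E p (X p) (D (E k) X p)"
  proof -
    have t: "E k p \<in> tangent_space M p" using frame_tangent p k by blast
    have "E k p (\<lambda>q. frame_metric I E q (X q) (X q)) = E k p (\<lambda>q. \<Sum>i\<in>I. x i q * x i q)"
      by (simp add: frame_metric_def x_def)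
    also have "\<dots> = (\<Sum>i\<in>I. E k p (\<lambda>q. x i q * x i q))"
      by (rule tangent_vector_sum[OF t p]) (rule smooth_near_mult[OF xs xs])
    also have "\<dots> = (\<Sum>i\<in>I. 2 * (x i p * E k p (x i)))"
      by (rule sum.cong[OF refl]) (simp add: tangent_vector_mult[OF t xs xs])
    finally show ?thesis
      using metric[OF Ek X X] by (simp add: frame_metric_def mult.commute flip: sum_distrib_left)
  qed
  have "D X (E k) p = comb (\<lambda>j. frame_coord I E p (D (E k) X p) j
      + ((\<Sum>i\<in>I. x i p * c p i k j) - E k p (x j))) p"
  proof
    fix f
    have "field_add (D X (E k)) (field_scale (\<lambda>p. - 1) (D (E k) X)) = lie_bracket M X (E k)"
      using LC X Ek by (simp add: levi_civita_def)
    then have "D X (E k) p f = D (E k) X p f + lie_bracket M X (E k) p f"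
      by (auto simp: field_add_def field_scale_def fun_eq_iff dest!: spec[of _ p] spec[of _ f])
    also have "D (E k) X p f = comb (frame_coord I E p (D (E k) X p)) p f"
      by (rule field_expansion[OF D_field[OF Ek X]])
    finally show "D X (E k) p f = comb (\<lambda>j. frame_coord I E p (D (E k) X p) j
      + ((\<Sum>i\<in>I. x i p * c p i k j) - E k p (x j))) p f"
      by (simp add: lie_bracket_frame[OF X p k] x_def[abs_def] distrib_right sum.distrib)
  qed
  then have coord: "frame_coord I E p (D X (E k) p) j = frame_coord I E p (D (E k) X p) j
      + ((\<Sum>i\<in>I. x i p * c p i k j) - E k p (x j))" if "j \<in> I" for j
    using frame_coord_comb[OF p] that by simp
  have "frame_metric I E p (X p) (D X (E k) p) = (\<Sum>j\<in>I. x j p * (frame_coord I E p (D (E k) X p) j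
      + ((\<Sum>i\<in>I. x i p * c p i k j) - E k p (x j))))"
    unfolding frame_metric_def x_def by (rule sum.cong) (simp_all add: coord x_def[abs_def])
  also have "\<dots> = frame_metric I E p (X p) (D (E k) X p)
      + (\<Sum>j\<in>I. x j p * (\<Sum>i\<in>I. x i p * c p i k j)) - (\<Sum>j\<in>I. x j p * E k p (x j))"
    by (simp add: frame_metric_def x_def[abs_def] distrib_left right_diff_distrib sum.distrib sum_subtractf)
  also have "\<dots> = (\<Sum>j\<in>I. \<Sum>i\<in>I. c p i k j * x i p * x j p)"
    unfolding m2[symmetric] by (simp add: sum_distrib_left mult_ac)
  also have "\<dots> = (\<Sum>i\<in>I. \<Sum>j\<in>I. c p i k j * x i p * x j p)"
    by (rule sum.swap)
  finally have "frame_metric I E p (X p) (D X (E k) p) = (\<Sum>i\<in>I. \<Sum>j\<in>I. c p i k j * x i p * x j p)" .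
  with m1 show ?thesis by (simp add: x_def[abs_def])
qed

abbreviation geodesic_defect :: "'a \<Rightarrow> (nat \<Rightarrow> real) \<Rightarrow> nat \<Rightarrow> real" where
  "geodesic_defect p x k \<equiv> - (\<Sum>i\<in>I. \<Sum>j\<in>I. c p i k j * x i * x j)"

lemma geodesic_comb:
  assumes p: "p \<in> points M"
  shows "D (comb x) (comb x) p = comb (geodesic_defect p x) p"
proof -
  have "comb x p (\<lambda>q. frame_coord I E q (comb x q) k) = 0" if "k \<in> I" for k
  proof -
    have "comb x p (\<lambda>q. frame_coord I E q (comb x q) k) = comb x p (\<lambda>q. x k)"
      by (rule tangent_vector_cong[OF comb_tangent[OF p]]) (simp add: frame_coord_comb that)
    then show ?thesis by (simp only: tangent_vector_const[OF comb_tangent[OF p]])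
  qed
  then have "frame_coord I E p (D (comb x) (comb x) p) k = geodesic_defect p x k" if "k \<in> I" for k
    using frame_coord_geodesic[OF comb_field p that, of x] that
    by (simp add: frame_coord_comb[OF p])
  then have "comb (frame_coord I E p (D (comb x) (comb x) p)) p = comb (geodesic_defect p x) p"
    by simp
  then show ?thesis
    using frame_expansion[OF vector_field_tangent[OF D_field[OF comb_field comb_field] p] p, of x x] by simp
qed

context
  fixes T C
  assumes T: "symmetric_3_tensor M T"
    and T_cubic: "\<And>p v. p \<in> points M \<Longrightarrow> v \<in> tangent_space M p \<Longrightarrow> T p v v v = C (frame_coord I E p v)"
    and C_restrict: "\<And>x. C (restrict x I) = C x"
begin

lemma tensor_swap:
  assumes "p \<in> points M" "u \<in> tangent_space M p" "v \<in> tangent_space M p" "w \<in> tangent_space M p"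
  shows "T p u v w = T p v u w" "T p u v w = T p u w v"
  using T assms unfolding symmetric_3_tensor_def by blast+

lemma tensor_rotate:
  assumes "p \<in> points M" "u \<in> tangent_space M p" "v \<in> tangent_space M p" "w \<in> tangent_space M p"
  shows "T p u v w = T p v w u"
  using tensor_swap[OF assms] tensor_swap[OF assms(1,3,2,4)] by simp

lemma tensor_linear:
  assumes "p \<in> points M" "u \<in> tangent_space M p" "z \<in> tangent_space M p"
    "v \<in> tangent_space M p" "w \<in> tangent_space M p"
  shows "T p (\<lambda>f. a * u f + b * z f) v w = a * T p u v w + b * T p z v w"
  using T assms unfolding symmetric_3_tensor_def by blast

lemma tensor_comb1:
  assumes p: "p \<in> points M" and v: "v \<in> tangent_space M p" and w: "w \<in> tangent_space M p"
  shows "T p (comb x p) v w = (\<Sum>i\<in>I. x i * T p (E i p) v w)"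
proof -
  have "T p (\<lambda>f. \<Sum>i\<in>J. x i * E i p f) v w = (\<Sum>i\<in>J. x i * T p (E i p) v w)" if "J \<subseteq> I" for J
    using finite_subset[OF that finite_index] that
  proof (induction J rule: finite_induct)
    case empty
    show ?case
      using tensor_linear[OF p v v v w, of 0 0] by simp
  next
    case (insert i J)
    have "(\<lambda>f. \<Sum>i\<in>J. x i * E i p f) \<in> tangent_space M p"
      using insert.prems frame_tangent[OF p] by (intro tangent_space_sum[OF p]) auto
    then show ?case
      using tensor_linear[OF p frame_tangent[OF p, of i] _ v w, of "\<lambda>f. \<Sum>i\<in>J. x i * E i p f" "x i" 1] insert
      by simp
  qed
  then show ?thesis by blast
qed

lemma tensor_comb3:
  assumes p: "p \<in> points M"
  shows "T p (comb x p) (comb y p) (comb z p)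
    = (\<Sum>i\<in>I. \<Sum>j\<in>I. \<Sum>k\<in>I. x i * (y j * (z k * T p (E i p) (E j p) (E k p))))"
proof -
  note t = comb_tangent[OF p] frame_tangent[OF p]
  have "T p (comb x p) (comb y p) (comb z p) = (\<Sum>i\<in>I. x i * T p (comb y p) (comb z p) (E i p))"
    unfolding tensor_comb1[OF p t(1) t(1)]
    by (intro sum.cong[OF refl] arg_cong[of _ _ "(*) _"] tensor_rotate[OF p] t)
  also have "\<dots> = (\<Sum>i\<in>I. x i * (\<Sum>j\<in>I. y j * T p (comb z p) (E i p) (E j p)))"
  proof (rule sum.cong[OF refl])
    fix i assume i: "i \<in> I"
    show "x i * T p (comb y p) (comb z p) (E i p) = x i * (\<Sum>j\<in>I. y j * T p (comb z p) (E i p) (E j p))"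
      unfolding tensor_comb1[OF p t(1) t(2)[OF i]]
      by (intro sum.cong[OF refl] arg_cong[of _ _ "(*) _"] tensor_rotate[OF p] t i)
  qed
  also have "\<dots> = (\<Sum>i\<in>I. x i * (\<Sum>j\<in>I. y j * (\<Sum>k\<in>I. z k * T p (E i p) (E j p) (E k p))))"
  proof (intro sum.cong[OF refl] arg_cong[of _ _ "(*) _"])
    fix i j assume i: "i \<in> I" and j: "j \<in> I"
    show "T p (comb z p) (E i p) (E j p) = (\<Sum>k\<in>I. z k * T p (E i p) (E j p) (E k p))"
      unfolding tensor_comb1[OF p t(2)[OF i] t(2)[OF j]]
      by (intro sum.cong[OF refl] arg_cong[of _ _ "(*) _"] tensor_rotate[OF p] t i j)
  qed
  finally show ?thesis by (simp add: sum_distrib_left)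
qed

lemma tensor_polarization:
  assumes p: "p \<in> points M"
  shows "T p (comb x p) (comb y p) (comb z p) = polarization C x y z"
proof -
  define B where "B x y z = T p (comb x p) (comb y p) (comb z p)" for x y z
  have B1: "B (\<lambda>i. x i + x' i) y z = B x y z + B x' y z" for x x' y z
    unfolding B_def tensor_comb1[OF p comb_tangent[OF p] comb_tangent[OF p]]
    by (simp add: distrib_right sum.distrib)
  have swap: "B x y z = B y x z" "B x y z = B x z y" for x y z
    unfolding B_def using tensor_swap[OF p] comb_tangent[OF p] by blast+
  have B2: "B y (\<lambda>i. x i + x' i) z = B y x z + B y x' z" for x x' y z
    using B1 swap by metis
  have B3: "B y z (\<lambda>i. x i + x' i) = B y z x + B y z x'" for x x' y z
    using B2 swap by metis
  have C: "C x = B x x x" for x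
    unfolding B_def T_cubic[OF p comb_tangent[OF p]] frame_coord_comb[OF p] C_restrict ..
  have two: "B y x x = B x x y" "B x y x = B x x y" for x y
    using swap by metis+
  have perm: "B x z y = B x y z" "B y x z = B x y z" "B y z x = B x y z" "B z x y = B x y z" "B z y x = B x y z"
    using swap by metis+
  have "B x y z = polarization C x y z"
    unfolding polarization_def C B1 B2 B3
    by (simp add: two[of x y] two[of y x] two[of x z] two[of z x] two[of y z] two[of z y] perm)
  then show ?thesis by (simp add: B_def)
qed

lemma tensor_frame_const:
  assumes "p \<in> points M" "q \<in> points M" "i \<in> I" "j \<in> I" "k \<in> I"
  shows "T p (E i p) (E j p) (E k p) = T q (E i q) (E j q) (E k q)"
  using tensor_polarization[OF assms(1), of "\<lambda>l. if l = i then 1 else 0" "\<lambda>l. if l = j then 1 else 0" "\<lambda>l. if l = k then 1 else 0"]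
    tensor_polarization[OF assms(2), of "\<lambda>l. if l = i then 1 else 0" "\<lambda>l. if l = j then 1 else 0" "\<lambda>l. if l = k then 1 else 0"]
  by (simp only: comb_delta_at assms(3-5))

lemma derivative_cubic:
  assumes X: "X \<in> vector_fields M" and p: "p \<in> points M"
  shows "X p (\<lambda>q. T q (X q) (X q) (X q))
    = 3 * T p (comb (\<lambda>k. X p (\<lambda>q. frame_coord I E q (X q) k)) p) (X p) (X p)"
proof -
  define x where "x i q = frame_coord I E q (X q) i" for i q
  define dx where "dx i = X p (x i)" for i
  define t where "t i j k = T p (E i p) (E j p) (E k p)" for i j k
  note v = vector_field_tangent[OF X p]
  have xs: "x i \<in> smooth_near M p" if "i \<in> I" for i
    unfolding x_def using smooth_near_frame_coord[OF X that p] by simp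
  note sm = smooth_near_mult smooth_near_sum[OF p] xs smooth_near_const[OF p]
  have Xq: "X q = comb (\<lambda>i. x i q) q" for q
    unfolding x_def by (rule ext) (rule field_expansion[OF X])
  have "X p (\<lambda>q. T q (X q) (X q) (X q))
      = X p (\<lambda>q. \<Sum>i\<in>I. \<Sum>j\<in>I. \<Sum>k\<in>I. x i q * (x j q * (x k q * t i j k)))"
  proof (rule tangent_vector_cong[OF v])
    fix q assume q: "q \<in> points M"
    show "T q (X q) (X q) (X q) = (\<Sum>i\<in>I. \<Sum>j\<in>I. \<Sum>k\<in>I. x i q * (x j q * (x k q * t i j k)))"
      unfolding Xq tensor_comb3[OF q] t_def
      by (intro sum.cong[OF refl]) (simp add: tensor_frame_const[OF p q])
  qed
  also have "\<dots> = (\<Sum>i\<in>I. X p (\<lambda>q. \<Sum>j\<in>I. \<Sum>k\<in>I. x i q * (x j q * (x k q * t i j k))))"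
    by (rule tangent_vector_sum[OF v p]) (intro sm; assumption)
  also have "\<dots> = (\<Sum>i\<in>I. \<Sum>j\<in>I. X p (\<lambda>q. \<Sum>k\<in>I. x i q * (x j q * (x k q * t i j k))))"
    by (rule sum.cong[OF refl], rule tangent_vector_sum[OF v p]) (intro sm; assumption)
  also have "\<dots> = (\<Sum>i\<in>I. \<Sum>j\<in>I. \<Sum>k\<in>I. X p (\<lambda>q. x i q * (x j q * (x k q * t i j k))))"
    by (rule sum.cong[OF refl], rule sum.cong[OF refl], rule tangent_vector_sum[OF v p]) (intro sm; assumption)
  also have "\<dots> = (\<Sum>i\<in>I. \<Sum>j\<in>I. \<Sum>k\<in>I. dx i * (x j p * (x k p * t i j k))
      + x i p * (dx j * (x k p * t i j k)) + x i p * (x j p * (dx k * t i j k)))"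
  proof (intro sum.cong[OF refl])
    fix i j k assume i: "i \<in> I" and j: "j \<in> I" and k: "k \<in> I"
    note s = xs[OF i] xs[OF j] xs[OF k]
    have s3: "(\<lambda>q. x k q * t i j k) \<in> smooth_near M p"
      by (rule smooth_near_mult[OF s(3) smooth_near_const[OF p]])
    have s2: "(\<lambda>q. x j q * (x k q * t i j k)) \<in> smooth_near M p"
      by (rule smooth_near_mult[OF s(2) s3])
    show "X p (\<lambda>q. x i q * (x j q * (x k q * t i j k))) = dx i * (x j p * (x k p * t i j k))
      + x i p * (dx j * (x k p * t i j k)) + x i p * (x j p * (dx k * t i j k))"
      unfolding tangent_vector_mult[OF v s(1) s2] tangent_vector_mult[OF v s(2) s3]
        tangent_vector_mult[OF v s(3) smooth_near_const[OF p]] tangent_vector_const[OF v] dx_def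
      by (simp add: algebra_simps)
  qed
  also have "\<dots> = T p (comb dx p) (X p) (X p) + T p (X p) (comb dx p) (X p) + T p (X p) (X p) (comb dx p)"
    unfolding Xq tensor_comb3[OF p] t_def by (simp add: sum.distrib)
  also have "\<dots> = 3 * T p (comb dx p) (X p) (X p)"
    using tensor_swap[OF p comb_tangent[OF p] v v, of dx] tensor_swap[OF p v comb_tangent[OF p] v, of dx] by simp
  finally show ?thesis by (simp add: dx_def x_def[abs_def])
qed

lemma cov_deriv_cubic:
  assumes X: "X \<in> vector_fields M" and p: "p \<in> points M"
  defines "x \<equiv> frame_coord I E p (X p)"
  shows "cov_deriv D X T X X X p = - 3 * polarization C (geodesic_defect p x) x x"
proof -
  define dx where "dx k = X p (\<lambda>q. frame_coord I E q (X q) k)" for k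
  note v = vector_field_tangent[OF X p] vector_field_tangent[OF D_field[OF X X] p]
  have Xp: "X p = comb x p"
    unfolding x_def by (rule frame_expansion[OF v(1) p])
  have "D X X p = comb (frame_coord I E p (D X X p)) p"
    by (rule frame_expansion[OF v(2) p])
  also have "\<dots> = comb (\<lambda>k. dx k + geodesic_defect p x k) p"
    using frame_coord_geodesic[OF X p] by (simp add: dx_def x_def)
  finally have "T p (D X X p) (X p) (X p) = T p (comb (\<lambda>k. dx k + geodesic_defect p x k) p) (X p) (X p)"
    by simp
  also have "\<dots> = T p (comb dx p) (X p) (X p) + T p (comb (geodesic_defect p x) p) (X p) (X p)"
    unfolding tensor_comb1[OF p v(1) v(1)] by (simp add: distrib_right left_diff_distrib sum.distrib sum_subtractf sum_negf)
  finally have "T p (D X X p) (X p) (X p)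
      = T p (comb dx p) (X p) (X p) + polarization C (geodesic_defect p x) x x"
    unfolding Xp tensor_polarization[OF p] .
  moreover have "T p (X p) (D X X p) (X p) = T p (D X X p) (X p) (X p)"
    "T p (X p) (X p) (D X X p) = T p (D X X p) (X p) (X p)"
    using tensor_swap[OF p v(2) v(1) v(1)] tensor_swap[OF p v(1) v(2) v(1)] by simp_all
  ultimately show ?thesis
    using derivative_cubic[OF X p] by (simp add: cov_deriv_def dx_def)
qed

lemma nearly_integrable_iff:
  "nearly_integrable M D T \<longleftrightarrow> (\<forall>p\<in>points M. \<forall>x. polarization C (geodesic_defect p x) x x = 0)"
proof
  assume *: "nearly_integrable M D T"
  show "\<forall>p\<in>points M. \<forall>x. polarization C (geodesic_defect p x) x x = 0"
  proof (intro ballI allI)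
    fix p x assume p: "p \<in> points M"
    have "polarization C (geodesic_defect p (restrict x I)) (restrict x I) (restrict x I) = 0"
      using cov_deriv_cubic[OF comb_field p, of x] * comb_field p unfolding nearly_integrable_def
      by (simp add: frame_coord_comb[OF p])
    moreover have "comb (restrict x I) p = comb x p" by simp
    moreover have "geodesic_defect p (restrict x I) = geodesic_defect p x" by simp
    ultimately show "polarization C (geodesic_defect p x) x x = 0"
      unfolding tensor_polarization[OF p, symmetric] by simp
  qed
next
  assume *: "\<forall>p\<in>points M. \<forall>x. polarization C (geodesic_defect p x) x x = 0"
  then show "nearly_integrable M D T"
    unfolding nearly_integrable_def by (simp add: cov_deriv_cubic)
qed

end

end

end

lemma levi_civita_lie_bracket:
  assumes "charted M" "levi_civita M g D" "X \<in> vector_fields M" "Y \<in> vector_fields M"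
  shows "lie_bracket M X Y \<in> vector_fields M"
proof -
  interpret charted M by fact
  have D: "D X Y \<in> vector_fields M" "D Y X \<in> vector_fields M"
    and b: "lie_bracket M X Y = field_add (D X Y) (field_scale (\<lambda>p. - 1) (D Y X))"
    using assms(2-4) by (simp_all add: levi_civita_def affine_connection_def)
  have "lie_bracket M X Y = (\<lambda>p f. \<Sum>i\<in>{0, 1::nat}. (if i = 0 then 1 else - 1) * (if i = 0 then D X Y else D Y X) p f)"
    by (simp add: b field_add_def field_scale_def)
  moreover have "\<dots> \<in> vector_fields M"
    by (rule vector_fields_sum) (use D in auto)
  ultimately show ?thesis by simp
qed

section \<open>Products\<close>

lemma atlas_prod_manifold:
  "(W, \<omega>) \<in> atlas (prod_manifold M N) \<longleftrightarrow>
    (\<exists>U \<phi> V \<psi>. (U, \<phi>) \<in> atlas M \<and> (V, \<psi>) \<in> atlas N \<and> W = U \<times> V \<and> \<omega> = map_prod \<phi> \<psi>)"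
  by (auto simp: prod_manifold_def)

lemma mtop_prod_manifold: "mtop (prod_manifold M N) = prod_topology (mtop M) (mtop N)"
  by (simp add: prod_manifold_def)

lemma points_prod_manifold: "points (prod_manifold M N) = points M \<times> points N"
  by (simp add: mtop_prod_manifold)

lemma inv_into_map_prod:
  assumes "inj_on \<phi> U" "inj_on \<psi> V" "y \<in> \<phi> ` U \<times> \<psi> ` V"
  shows "inv_into (U \<times> V) (map_prod \<phi> \<psi>) y = (inv_into U \<phi> (fst y), inv_into V \<psi> (snd y))"
proof (rule inv_into_f_eq[OF map_prod_inj_on[OF assms(1,2)]])
  show "(inv_into U \<phi> (fst y), inv_into V \<psi> (snd y)) \<in> U \<times> V"
    using assms(3) by (auto simp: inv_into_into)
  show "map_prod \<phi> \<psi> (inv_into U \<phi> (fst y), inv_into V \<psi> (snd y)) = y"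
    using assms(3) by (auto simp: f_inv_into_f)
qed

lemma charted_prod_manifold:
  assumes "charted M" "charted N"
  shows "charted (prod_manifold M N)"
proof -
  interpret M: charted M by fact
  interpret N: charted N by fact
  have image_open: "open (map_prod \<phi> \<psi> ` (W \<inter> U \<times> V))"
    if c: "(U, \<phi>) \<in> atlas M" "(V, \<psi>) \<in> atlas N" and W: "openin (prod_topology (mtop M) (mtop N)) W"
    for U \<phi> V \<psi> W
    unfolding open_prod_def
  proof
    fix y assume "y \<in> map_prod \<phi> \<psi> ` (W \<inter> U \<times> V)"
    then obtain p q where y: "y = (\<phi> p, \<psi> q)" "(p, q) \<in> W" "p \<in> U" "q \<in> V" by auto
    obtain A B where AB: "openin (mtop M) A" "openin (mtop N) B" "p \<in> A" "q \<in> B" "A \<times> B \<subseteq> W"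
      using W[unfolded openin_prod_topology_alt, rule_format, OF y(2)] by metis
    have "\<phi> ` (A \<inter> U) \<times> \<psi> ` (B \<inter> V) \<subseteq> map_prod \<phi> \<psi> ` (W \<inter> U \<times> V)"
    proof
      fix z assume "z \<in> \<phi> ` (A \<inter> U) \<times> \<psi> ` (B \<inter> V)"
      then obtain a b where "z = map_prod \<phi> \<psi> (a, b)" "(a, b) \<in> A \<times> B" "(a, b) \<in> U \<times> V"
        by auto
      with AB(5) show "z \<in> map_prod \<phi> \<psi> ` (W \<inter> U \<times> V)" by blast
    qed
    moreover have "y \<in> \<phi> ` (A \<inter> U) \<times> \<psi> ` (B \<inter> V)" using y AB(3,4) by blast
    ultimately show "\<exists>A B. open A \<and> open B \<and> y \<in> A \<times> B \<and> A \<times> B \<subseteq> map_prod \<phi> \<psi> ` (W \<inter> U \<times> V)"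
      using M.chart_image_open[OF c(1) AB(1)] N.chart_image_open[OF c(2) AB(2)] by blast
  qed
  have openin: "openin (prod_topology (mtop M) (mtop N)) (U \<times> V)"
    if "(U, \<phi>) \<in> atlas M" "(V, \<psi>) \<in> atlas N" for U \<phi> V \<psi>
    using that M.chart_openin N.chart_openin by (simp add: openin_prod_Times_iff)
  show ?thesis
  proof
    fix W \<omega> assume "(W, \<omega>) \<in> atlas (prod_manifold M N)"
    then obtain U \<phi> V \<psi> where c: "(U, \<phi>) \<in> atlas M" "(V, \<psi>) \<in> atlas N"
      and W: "W = U \<times> V" "\<omega> = map_prod \<phi> \<psi>" by (auto simp: atlas_prod_manifold)
    show "openin (mtop (prod_manifold M N)) W"
      unfolding W mtop_prod_manifold by (rule openin[OF c])
    show "inj_on \<omega> W"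
      unfolding W by (rule map_prod_inj_on[OF M.chart_inj[OF c(1)] N.chart_inj[OF c(2)]])
    show "open (\<omega> ` (S \<inter> W))" if "openin (mtop (prod_manifold M N)) S" for S
      unfolding W by (rule image_open[OF c that[unfolded mtop_prod_manifold]])
    fix W' \<omega>' assume "(W', \<omega>') \<in> atlas (prod_manifold M N)"
    then obtain U' \<phi>' V' \<psi>' where c': "(U', \<phi>') \<in> atlas M" "(V', \<psi>') \<in> atlas N"
      and W': "W' = U' \<times> V'" "\<omega>' = map_prod \<phi>' \<psi>'" by (auto simp: atlas_prod_manifold)
    have o: "open (\<omega> ` (W \<inter> W'))"
      using image_open[OF c openin[OF c']] by (simp add: W W' Int_commute)
    have t: "smooth_on (\<omega> ` (W \<inter> W')) (\<lambda>y. ((\<phi>' \<circ> inv_into U \<phi>) (fst y), (\<psi>' \<circ> inv_into V \<psi>) (snd y)))"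
      by (intro smooth_on_Pair[OF o] smooth_on_linear_precomp[OF o bounded_linear_fst M.chart_transition[OF c(1) c'(1)]]
          smooth_on_linear_precomp[OF o bounded_linear_snd N.chart_transition[OF c(2) c'(2)]])
        (auto simp: W W')
    show "smooth_on (\<omega> ` (W \<inter> W')) (\<omega>' \<circ> inv_into W \<omega>)"
    proof (rule smooth_on_cong[OF o _ t])
      fix y assume "y \<in> \<omega> ` (W \<inter> W')"
      then have "y \<in> \<phi> ` U \<times> \<psi> ` V" by (auto simp: W W')
      then show "((\<phi>' \<circ> inv_into U \<phi>) (fst y), (\<psi>' \<circ> inv_into V \<psi>) (snd y)) = (\<omega>' \<circ> inv_into W \<omega>) y"
        using inv_into_map_prod[OF M.chart_inj[OF c(1)] N.chart_inj[OF c(2)]] by (simp add: W W')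
    qed
  next
    fix z assume "z \<in> points (prod_manifold M N)"
    then obtain U \<phi> V \<psi> where "(U, \<phi>) \<in> atlas M" "(V, \<psi>) \<in> atlas N" "z \<in> U \<times> V"
      unfolding points_prod_manifold using M.ex_chart[of "fst z"] N.ex_chart[of "snd z"] by (auto simp: mem_Times_iff)
    then show "\<exists>W \<omega>. (W, \<omega>) \<in> atlas (prod_manifold M N) \<and> z \<in> W"
      unfolding atlas_prod_manifold by blast
  qed
qed

locale charted_pair = M: charted M + N: charted N
  for M :: "('a, 'e::euclidean_space) manifold" and N :: "('b, 'f::euclidean_space) manifold"
begin

abbreviation "P \<equiv> prod_manifold M N"

sublocale P: charted P
  using charted_prod_manifold M.charted_axioms N.charted_axioms by blast

lemma prod_chart: "(U, \<phi>) \<in> atlas M \<Longrightarrow> (V, \<psi>) \<in> atlas N \<Longrightarrow> (U \<times> V, map_prod \<phi> \<psi>) \<in> atlas P"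
  unfolding atlas_prod_manifold by blast

lemma inv_into_prod_chart:
  "(U, \<phi>) \<in> atlas M \<Longrightarrow> (V, \<psi>) \<in> atlas N \<Longrightarrow> y \<in> \<phi> ` U \<times> \<psi> ` V \<Longrightarrow>
    inv_into (U \<times> V) (map_prod \<phi> \<psi>) y = (inv_into U \<phi> (fst y), inv_into V \<psi> (snd y))"
  by (rule inv_into_map_prod[OF M.chart_inj N.chart_inj])

lemma smooth_fun_on_prodI:
  assumes "openin (mtop P) W"
    and "\<And>U \<phi> V \<psi>. (U, \<phi>) \<in> atlas M \<Longrightarrow> (V, \<psi>) \<in> atlas N \<Longrightarrow> open (map_prod \<phi> \<psi> ` (W \<inter> U \<times> V)) \<Longrightarrow>
      smooth_on (map_prod \<phi> \<psi> ` (W \<inter> U \<times> V)) (\<lambda>y. f (inv_into U \<phi> (fst y), inv_into V \<psi> (snd y)))"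
  shows "smooth_fun_on P W f"
proof (rule P.smooth_fun_onI[OF assms(1)])
  fix S \<omega> assume "(S, \<omega>) \<in> atlas P" and o: "open (\<omega> ` (W \<inter> S))"
  then obtain U \<phi> V \<psi> where c: "(U, \<phi>) \<in> atlas M" "(V, \<psi>) \<in> atlas N"
    and S: "S = U \<times> V" "\<omega> = map_prod \<phi> \<psi>" by (auto simp: atlas_prod_manifold)
  note o = o[unfolded S]
  show "smooth_on (\<omega> ` (W \<inter> S)) (f \<circ> inv_into S \<omega>)"
    unfolding S
    by (rule smooth_on_cong[OF o _ assms(2)[OF c o]])
      (subst comp_apply, subst inv_into_prod_chart[OF c], auto)
qed

lemma smooth_near_fst:
  assumes "f \<in> smooth_near M p" "q \<in> points N"
  shows "(\<lambda>z. f (fst z)) \<in> smooth_near P (p, q)"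
proof -
  obtain A where A: "p \<in> A" "smooth_fun_on M A f"
    using assms(1) by (auto simp: smooth_near_def)
  have "smooth_fun_on P (A \<times> points N) (\<lambda>z. f (fst z))"
  proof (rule smooth_fun_on_prodI)
    show "openin (mtop P) (A \<times> points N)"
      using smooth_fun_on_openin[OF A(2)] by (simp add: mtop_prod_manifold openin_prod_Times_iff)
    fix U \<phi> V \<psi>
    assume c: "(U, \<phi>) \<in> atlas M" "(V, \<psi>) \<in> atlas N"
      and o: "open (map_prod \<phi> \<psi> ` (A \<times> points N \<inter> U \<times> V))"
    have "smooth_on (map_prod \<phi> \<psi> ` (A \<times> points N \<inter> U \<times> V)) (\<lambda>y. (f \<circ> inv_into U \<phi>) (fst y))"
      by (rule smooth_on_linear_precomp[OF o bounded_linear_fst smooth_fun_onD[OF A(2) c(1)]]) auto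
    then show "smooth_on (map_prod \<phi> \<psi> ` (A \<times> points N \<inter> U \<times> V))
        (\<lambda>y. f (fst (inv_into U \<phi> (fst y), inv_into V \<psi> (snd y))))"
      by (simp add: o_def)
  qed
  then show ?thesis
    unfolding smooth_near_def using A(1) assms(2) by (intro CollectI exI[of _ "A \<times> points N"]) simp
qed

lemma smooth_near_snd:
  assumes "g \<in> smooth_near N q" "p \<in> points M"
  shows "(\<lambda>z. g (snd z)) \<in> smooth_near P (p, q)"
proof -
  obtain B where B: "q \<in> B" "smooth_fun_on N B g"
    using assms(1) by (auto simp: smooth_near_def)
  have "smooth_fun_on P (points M \<times> B) (\<lambda>z. g (snd z))"
  proof (rule smooth_fun_on_prodI)
    show "openin (mtop P) (points M \<times> B)"
      using smooth_fun_on_openin[OF B(2)] by (simp add: mtop_prod_manifold openin_prod_Times_iff)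
    fix U \<phi> V \<psi>
    assume c: "(U, \<phi>) \<in> atlas M" "(V, \<psi>) \<in> atlas N"
      and o: "open (map_prod \<phi> \<psi> ` (points M \<times> B \<inter> U \<times> V))"
    have "smooth_on (map_prod \<phi> \<psi> ` (points M \<times> B \<inter> U \<times> V)) (\<lambda>y. (g \<circ> inv_into V \<psi>) (snd y))"
      by (rule smooth_on_linear_precomp[OF o bounded_linear_snd smooth_fun_onD[OF B(2) c(2)]]) auto
    then show "smooth_on (map_prod \<phi> \<psi> ` (points M \<times> B \<inter> U \<times> V))
        (\<lambda>y. g (snd (inv_into U \<phi> (fst y), inv_into V \<psi> (snd y))))"
      by (simp add: o_def)
  qed
  then show ?thesis
    unfolding smooth_near_def using B(1) assms(2) by (intro CollectI exI[of _ "points M \<times> B"]) simp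
qed

lemma smooth_near_slice_fst:
  assumes "f \<in> smooth_near P (p, q)"
  shows "(\<lambda>x. f (x, q)) \<in> smooth_near M p"
proof -
  obtain W where W: "(p, q) \<in> W" "smooth_fun_on P W f"
    using assms by (auto simp: smooth_near_def)
  have q: "q \<in> points N" using smooth_near_points[OF assms] by (simp add: points_prod_manifold)
  obtain V \<psi> where V: "(V, \<psi>) \<in> atlas N" "q \<in> V" using N.ex_chart[OF q] by blast
  define A where "A = {x \<in> points M. (x, q) \<in> W}"
  have "smooth_fun_on M A (\<lambda>x. f (x, q))"
  proof (rule M.smooth_fun_onI)
    have "continuous_map (mtop M) (mtop P) (\<lambda>x. (x, q))"
      using q by (simp add: mtop_prod_manifold continuous_map_paired)
    then show "openin (mtop M) A"
      unfolding A_def using openin_continuous_map_preimage smooth_fun_on_openin[OF W(2)] by blast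
    fix U \<phi> assume c: "(U, \<phi>) \<in> atlas M" and o: "open (\<phi> ` (A \<inter> U))"
    have s: "smooth_on (\<phi> ` (A \<inter> U)) (\<lambda>y. (f \<circ> inv_into (U \<times> V) (map_prod \<phi> \<psi>)) ((0, \<psi> q) + (y, 0)))"
      by (rule smooth_on_affine_precomp[OF o _ smooth_fun_onD[OF W(2) prod_chart[OF c V(1)]]])
        (use V(2) in \<open>auto simp: A_def bounded_linear_Pair bounded_linear_ident bounded_linear_zero\<close>)
    show "smooth_on (\<phi> ` (A \<inter> U)) ((\<lambda>x. f (x, q)) \<circ> inv_into U \<phi>)"
      by (rule smooth_on_cong[OF o _ s])
        (use V(2) in \<open>auto simp: inv_into_prod_chart[OF c V(1)] N.chart_inj[OF V(1)]\<close>)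
  qed
  moreover have "p \<in> A"
    using W(1) smooth_near_points[OF assms] by (simp add: A_def points_prod_manifold)
  ultimately show ?thesis unfolding smooth_near_def by blast
qed

lemma smooth_near_slice_snd:
  assumes "f \<in> smooth_near P (p, q)"
  shows "(\<lambda>y. f (p, y)) \<in> smooth_near N q"
proof -
  obtain W where W: "(p, q) \<in> W" "smooth_fun_on P W f"
    using assms by (auto simp: smooth_near_def)
  have p: "p \<in> points M" using smooth_near_points[OF assms] by (simp add: points_prod_manifold)
  obtain U \<phi> where U: "(U, \<phi>) \<in> atlas M" "p \<in> U" using M.ex_chart[OF p] by blast
  define B where "B = {y \<in> points N. (p, y) \<in> W}"
  have "smooth_fun_on N B (\<lambda>y. f (p, y))"
  proof (rule N.smooth_fun_onI)
    have "continuous_map (mtop N) (mtop P) (\<lambda>y. (p, y))"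
      using p by (simp add: mtop_prod_manifold continuous_map_paired)
    then show "openin (mtop N) B"
      unfolding B_def using openin_continuous_map_preimage smooth_fun_on_openin[OF W(2)] by blast
    fix V \<psi> assume c: "(V, \<psi>) \<in> atlas N" and o: "open (\<psi> ` (B \<inter> V))"
    have s: "smooth_on (\<psi> ` (B \<inter> V)) (\<lambda>y. (f \<circ> inv_into (U \<times> V) (map_prod \<phi> \<psi>)) ((\<phi> p, 0) + (0, y)))"
      by (rule smooth_on_affine_precomp[OF o _ smooth_fun_onD[OF W(2) prod_chart[OF U(1) c]]])
        (use U(2) in \<open>auto simp: B_def bounded_linear_Pair bounded_linear_ident bounded_linear_zero\<close>)
    show "smooth_on (\<psi> ` (B \<inter> V)) ((\<lambda>y. f (p, y)) \<circ> inv_into V \<psi>)"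
      by (rule smooth_on_cong[OF o _ s])
        (use U(2) in \<open>auto simp: inv_into_prod_chart[OF U(1) c] M.chart_inj[OF U(1)]\<close>)
  qed
  moreover have "q \<in> B"
    using W(1) smooth_near_points[OF assms] by (simp add: B_def points_prod_manifold)
  ultimately show ?thesis unfolding smooth_near_def by blast
qed

lemma smooth_near_fst_iff:
  "p \<in> points M \<Longrightarrow> q \<in> points N \<Longrightarrow> (\<lambda>z. f (fst z)) \<in> smooth_near P (p, q) \<longleftrightarrow> f \<in> smooth_near M p"
  using smooth_near_fst smooth_near_slice_fst[of "\<lambda>z. f (fst z)"] by auto

lemma smooth_near_snd_iff:
  "p \<in> points M \<Longrightarrow> q \<in> points N \<Longrightarrow> (\<lambda>z. g (snd z)) \<in> smooth_near P (p, q) \<longleftrightarrow> g \<in> smooth_near N q"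
  using smooth_near_snd smooth_near_slice_snd[of "\<lambda>z. g (snd z)"] by auto

definition sum_field :: "'a vector_field \<Rightarrow> 'b vector_field \<Rightarrow> ('a \<times> 'b) vector_field" where
  "sum_field X Y = (\<lambda>(p, q) f. pushforward P (\<lambda>x. (x, q)) p (X p) f + pushforward P (\<lambda>y. (p, y)) q (Y q) f)"

lemma sum_field_chart:
  assumes c: "(U, \<phi>) \<in> atlas M" "(V, \<psi>) \<in> atlas N" and pq: "p \<in> U" "q \<in> V"
    and X: "X p = coordinate_vector M U \<phi> p a" and Y: "Y q = coordinate_vector N V \<psi> q b"
  shows "sum_field X Y (p, q) = coordinate_vector P (U \<times> V) (map_prod \<phi> \<psi>) (p, q) (a, b)"
proof
  fix f
  show "sum_field X Y (p, q) f = coordinate_vector P (U \<times> V) (map_prod \<phi> \<psi>) (p, q) (a, b) f"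
  proof (cases "f \<in> smooth_near P (p, q)")
    case True
    define F where "F = f \<circ> inv_into (U \<times> V) (map_prod \<phi> \<psi>)"
    define F' where "F' = frechet_derivative F (at (\<phi> p, \<psi> q))"
    have F: "(F has_derivative F') (at (\<phi> p, \<psi> q))"
      using P.smooth_near_has_derivative[OF True prod_chart[OF c]] pq by (simp add: F_def F'_def)
    have "((\<lambda>y. F (y, \<psi> q)) has_derivative (\<lambda>v. F' (v, 0))) (at (\<phi> p))"
      by (rule has_derivative_compose[of "\<lambda>y. (y, \<psi> q)" "\<lambda>v. (v, 0)"])
        (auto intro!: derivative_eq_intros F)
    then have 1: "((\<lambda>x. f (x, q)) \<circ> inv_into U \<phi> has_derivative (\<lambda>v. F' (v, 0))) (at (\<phi> p))"
      by (rule has_derivative_transform_within_open[OF _ M.chart_image_openin[OF c(1)]])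
        (use pq in \<open>auto simp: F_def inv_into_prod_chart[OF c] N.chart_inj[OF c(2)]\<close>)
    have "((\<lambda>y. F (\<phi> p, y)) has_derivative (\<lambda>v. F' (0, v))) (at (\<psi> q))"
      by (rule has_derivative_compose[of "\<lambda>y. (\<phi> p, y)" "\<lambda>v. (0, v)"])
        (auto intro!: derivative_eq_intros F)
    then have 2: "((\<lambda>y. f (p, y)) \<circ> inv_into V \<psi> has_derivative (\<lambda>v. F' (0, v))) (at (\<psi> q))"
      by (rule has_derivative_transform_within_open[OF _ N.chart_image_openin[OF c(2)]])
        (use pq in \<open>auto simp: F_def inv_into_prod_chart[OF c] M.chart_inj[OF c(1)]\<close>)
    have "sum_field X Y (p, q) f = F' (a, 0) + F' (0, b)"
      using True M.coordinate_vector_eqI[OF smooth_near_slice_fst[OF True] 1]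
        N.coordinate_vector_eqI[OF smooth_near_slice_snd[OF True] 2]
      by (simp add: sum_field_def pushforward_def X Y o_def)
    also have "\<dots> = F' (a, b)"
      using linear_add[OF has_derivative_linear[OF F], of "(a, 0)" "(0, b)"] by simp
    finally show ?thesis
      using True by (simp add: coordinate_vector_def F'_def F_def)
  qed (simp add: sum_field_def pushforward_def coordinate_vector_def)
qed

lemma sum_field_fst:
  assumes X: "X \<in> vector_fields M" and Y: "Y \<in> vector_fields N" and pq: "p \<in> points M" "q \<in> points N"
  shows "sum_field X Y (p, q) (\<lambda>z. f (fst z)) = X p f"
proof (cases "f \<in> smooth_near M p")
  case True
  then show ?thesis
    using smooth_near_fst_iff[OF pq] N.tangent_vector_const[OF N.vector_field_tangent[OF Y pq(2)]]
    by (simp add: sum_field_def pushforward_def o_def)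
next
  case False
  then show ?thesis
    using smooth_near_fst_iff[OF pq] tangent_vector_not_smooth_near[OF M.vector_field_tangent[OF X pq(1)]]
    by (simp add: sum_field_def pushforward_def)
qed

lemma sum_field_snd:
  assumes X: "X \<in> vector_fields M" and Y: "Y \<in> vector_fields N" and pq: "p \<in> points M" "q \<in> points N"
  shows "sum_field X Y (p, q) (\<lambda>z. g (snd z)) = Y q g"
proof (cases "g \<in> smooth_near N q")
  case True
  then show ?thesis
    using smooth_near_snd_iff[OF pq] M.tangent_vector_const[OF M.vector_field_tangent[OF X pq(1)]]
    by (simp add: sum_field_def pushforward_def o_def)
next
  case False
  then show ?thesis
    using smooth_near_snd_iff[OF pq] tangent_vector_not_smooth_near[OF N.vector_field_tangent[OF Y pq(2)]]
    by (simp add: sum_field_def pushforward_def)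
qed

lemma sum_field_vector_field:
  assumes X: "X \<in> vector_fields M" and Y: "Y \<in> vector_fields N"
  shows "sum_field X Y \<in> vector_fields P"
proof -
  define r where "r \<phi> p = (\<Sum>b\<in>Basis. X p (\<lambda>x. \<phi> x \<bullet> b) *\<^sub>R b)" for \<phi> :: "'a \<Rightarrow> 'e" and p
  define s where "s \<psi> q = (\<Sum>b\<in>Basis. Y q (\<lambda>y. \<psi> y \<bullet> b) *\<^sub>R b)" for \<psi> :: "'b \<Rightarrow> 'f" and q
  have chart: "sum_field X Y (p, q) = coordinate_vector P (U \<times> V) (map_prod \<phi> \<psi>) (p, q) (r \<phi> p, s \<psi> q)"
    if "(U, \<phi>) \<in> atlas M" "(V, \<psi>) \<in> atlas N" "p \<in> U" "q \<in> V" for U \<phi> V \<psi> p q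
    unfolding r_def s_def
  proof (rule sum_field_chart[OF that])
    show "X p = coordinate_vector M U \<phi> p (\<Sum>b\<in>Basis. X p (\<lambda>x. \<phi> x \<bullet> b) *\<^sub>R b)"
      using M.tangent_vector_chart_expansion[OF M.vector_field_tangent[OF X] that(1,3)] M.chart_subset that by blast
    show "Y q = coordinate_vector N V \<psi> q (\<Sum>b\<in>Basis. Y q (\<lambda>y. \<psi> y \<bullet> b) *\<^sub>R b)"
      using N.tangent_vector_chart_expansion[OF N.vector_field_tangent[OF Y] that(2,4)] N.chart_subset that by blast
  qed
  have "sum_field X Y z \<in> tangent_space P z" if z': "z \<in> points P" for z
  proof -
    obtain p q where z: "z = (p, q)" "p \<in> points M" "q \<in> points N"
      using z' by (auto simp: points_prod_manifold)
    obtain U \<phi> V \<psi> where c: "(U, \<phi>) \<in> atlas M" "(V, \<psi>) \<in> atlas N" "p \<in> U" "q \<in> V"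
      using M.ex_chart[OF z(2)] N.ex_chart[OF z(3)] by blast
    show ?thesis
      unfolding tangent_space_eq z(1) chart[OF c] using prod_chart[OF c(1,2)] c(3,4) by blast
  qed
  moreover have "sum_field X Y z = (\<lambda>f. 0)" if "z \<notin> points P" for z
  proof -
    have "f \<notin> smooth_near P z" for f using that smooth_near_points[of f P z] by argo
    then show ?thesis by (auto simp: sum_field_def pushforward_def split: prod.splits)
  qed
  moreover have "smooth_fun_on P W (\<lambda>z. sum_field X Y z f)" if f: "smooth_fun_on P W f" for W f
  proof (rule smooth_fun_on_prodI)
    show "openin (mtop P) W" using f smooth_fun_on_openin by blast
    fix U \<phi> V \<psi>
    assume c: "(U, \<phi>) \<in> atlas M" "(V, \<psi>) \<in> atlas N" and o: "open (map_prod \<phi> \<psi> ` (W \<inter> U \<times> V))"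
    define S where "S = map_prod \<phi> \<psi> ` (W \<inter> U \<times> V)"
    note o = o[folded S_def]
    define F where "F = f \<circ> inv_into (U \<times> V) (map_prod \<phi> \<psi>)"
    have F: "smooth_on S F"
      unfolding F_def S_def by (rule smooth_fun_onD[OF f prod_chart[OF c]])
    have "smooth_fun_on M U (\<lambda>x. X x (\<lambda>x. \<phi> x \<bullet> b))" for b
      using X M.smooth_fun_on_chart[OF c(1)] unfolding vector_fields_def by blast
    from smooth_fun_onD[OF this c(1)]
    have "smooth_on S (\<lambda>y. ((\<lambda>x. X x (\<lambda>x. \<phi> x \<bullet> b)) \<circ> inv_into U \<phi>) (fst y))" for b
      by (rule smooth_on_linear_precomp[OF o bounded_linear_fst]) (auto simp: S_def)
    then have r: "smooth_on S (\<lambda>y. X (inv_into U \<phi> (fst y)) (\<lambda>x. \<phi> x \<bullet> b))" for b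
      by (simp add: o_def)
    have "smooth_fun_on N V (\<lambda>y. Y y (\<lambda>y. \<psi> y \<bullet> b))" for b
      using Y N.smooth_fun_on_chart[OF c(2)] unfolding vector_fields_def by blast
    from smooth_fun_onD[OF this c(2)]
    have "smooth_on S (\<lambda>y. ((\<lambda>y. Y y (\<lambda>y. \<psi> y \<bullet> b)) \<circ> inv_into V \<psi>) (snd y))" for b
      by (rule smooth_on_linear_precomp[OF o bounded_linear_snd]) (auto simp: S_def)
    then have s: "smooth_on S (\<lambda>y. Y (inv_into V \<psi> (snd y)) (\<lambda>y. \<psi> y \<bullet> b))" for b
      by (simp add: o_def)
    have smooth: "smooth_on S (\<lambda>y.
       (\<Sum>b\<in>Basis. X (inv_into U \<phi> (fst y)) (\<lambda>x. \<phi> x \<bullet> b) * frechet_derivative F (at y) (b, 0))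
     + (\<Sum>b\<in>Basis. Y (inv_into V \<psi> (snd y)) (\<lambda>x. \<psi> x \<bullet> b) * frechet_derivative F (at y) (0, b)))"
      by (intro smooth_on_add smooth_on_sum smooth_on_mult o r s smooth_on_frechet_derivative[OF F])
    show "smooth_on (map_prod \<phi> \<psi> ` (W \<inter> U \<times> V))
        (\<lambda>y. sum_field X Y (inv_into U \<phi> (fst y), inv_into V \<psi> (snd y)) f)"
      unfolding S_def[symmetric]
    proof (rule smooth_on_cong[OF o _ smooth])
      fix y assume "y \<in> S"
      then obtain p q where y: "y = (\<phi> p, \<psi> q)" "(p, q) \<in> W" "p \<in> U" "q \<in> V" by (auto simp: S_def)
      have inv: "inv_into U \<phi> (\<phi> p) = p" "inv_into V \<psi> (\<psi> q) = q"
        using M.chart_inj[OF c(1)] N.chart_inj[OF c(2)] y by auto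
      have fn: "f \<in> smooth_near P (p, q)" using f y(2) by (auto simp: smooth_near_def)
      have L: "linear (frechet_derivative F (at y))"
        using smooth_on_has_derivative[OF F \<open>y \<in> S\<close>] has_derivative_linear by blast
      have "(r \<phi> p, s \<psi> q) = (\<Sum>b\<in>Basis. X p (\<lambda>x. \<phi> x \<bullet> b) *\<^sub>R (b, 0)) + (\<Sum>b\<in>Basis. Y q (\<lambda>x. \<psi> x \<bullet> b) *\<^sub>R (0, b))"
        by (simp add: r_def s_def prod_eq_iff fst_sum snd_sum)
      then have "frechet_derivative F (at y) (r \<phi> p, s \<psi> q)
         = (\<Sum>b\<in>Basis. X p (\<lambda>x. \<phi> x \<bullet> b) * frechet_derivative F (at y) (b, 0))
         + (\<Sum>b\<in>Basis. Y q (\<lambda>x. \<psi> x \<bullet> b) * frechet_derivative F (at y) (0, b))"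
        by (simp only: linear_add[OF L] linear_sum[OF L] linear_cmul[OF L] real_scaleR_def)
      moreover have "sum_field X Y (p, q) f = frechet_derivative F (at y) (r \<phi> p, s \<psi> q)"
        unfolding chart[OF c y(3,4)] coordinate_vector_def F_def y(1) using fn by simp
      ultimately show "(\<Sum>b\<in>Basis. X (inv_into U \<phi> (fst y)) (\<lambda>x. \<phi> x \<bullet> b) * frechet_derivative F (at y) (b, 0))
          + (\<Sum>b\<in>Basis. Y (inv_into V \<psi> (snd y)) (\<lambda>x. \<psi> x \<bullet> b) * frechet_derivative F (at y) (0, b))
          = sum_field X Y (inv_into U \<phi> (fst y), inv_into V \<psi> (snd y)) f"
        by (simp add: y(1) inv)
    qed
  qed
  ultimately show ?thesis unfolding vector_fields_def by blast
qed

lemma tangent_space_prod_eqI: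
  assumes v: "v \<in> tangent_space P (p, q)" and w: "w \<in> tangent_space P (p, q)"
    and fst: "\<And>f. v (\<lambda>z. f (fst z)) = w (\<lambda>z. f (fst z))"
    and snd: "\<And>g. v (\<lambda>z. g (snd z)) = w (\<lambda>z. g (snd z))"
    and pq: "p \<in> points M" "q \<in> points N"
  shows "v = w"
proof -
  obtain U \<phi> V \<psi> where c: "(U, \<phi>) \<in> atlas M" "(V, \<psi>) \<in> atlas N" "p \<in> U" "q \<in> V"
    using M.ex_chart[OF pq(1)] N.ex_chart[OF pq(2)] by blast
  show ?thesis
  proof (rule P.tangent_space_eqI[OF v w prod_chart[OF c(1,2)]])
    fix b :: "'e \<times> 'f" assume "b \<in> Basis"
    then consider u where "b = (u, 0)" | u where "b = (0, u)"
      by (auto simp: Basis_prod_def)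
    then show "v (\<lambda>z. map_prod \<phi> \<psi> z \<bullet> b) = w (\<lambda>z. map_prod \<phi> \<psi> z \<bullet> b)"
      by cases (auto simp: map_prod_def case_prod_unfold inner_prod_def
          fst[of "\<lambda>x. \<phi> x \<bullet> _"] snd[of "\<lambda>x. \<psi> x \<bullet> _"])
  qed (use c in auto)
qed

lemma tangent_space_prod_components:
  assumes v: "v \<in> tangent_space P (p, q)" and pq: "p \<in> points M" "q \<in> points N"
  shows "(\<lambda>f. v (\<lambda>z. f (fst z))) \<in> tangent_space M p" and "(\<lambda>g. v (\<lambda>z. g (snd z))) \<in> tangent_space N q"
proof -
  obtain U \<phi> V \<psi> where c: "(U, \<phi>) \<in> atlas M" "(V, \<psi>) \<in> atlas N" "p \<in> U" "q \<in> V"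
    using M.ex_chart[OF pq(1)] N.ex_chart[OF pq(2)] by blast
  note c' = prod_chart[OF c(1,2)]
  obtain ab where "v = coordinate_vector P (U \<times> V) (map_prod \<phi> \<psi>) (p, q) ab"
    using P.tangent_space_chartE[OF v c'] c(3,4) by auto
  then obtain a b where ab: "v = coordinate_vector P (U \<times> V) (map_prod \<phi> \<psi>) (p, q) (a, b)"
    by (cases ab) auto
  have o: "open (map_prod \<phi> \<psi> ` (U \<times> V))" using P.chart_image_openin[OF c'] .
  have "v (\<lambda>z. f (fst z)) = coordinate_vector M U \<phi> p a f" for f
  proof (cases "f \<in> smooth_near M p")
    case True
    note d = M.smooth_near_has_derivative[OF True c(1,3)]
    have "((\<lambda>y. (f \<circ> inv_into U \<phi>) (fst y)) has_derivative
        (\<lambda>u. frechet_derivative (f \<circ> inv_into U \<phi>) (at (\<phi> p)) (fst u))) (at (map_prod \<phi> \<psi> (p, q)))"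
      by (rule has_derivative_compose[OF bounded_linear_imp_has_derivative[OF bounded_linear_fst]])
        (simp only: map_prod_simp fst_conv, rule d)
    then have "((\<lambda>z. f (fst z)) \<circ> inv_into (U \<times> V) (map_prod \<phi> \<psi>) has_derivative
        (\<lambda>u. frechet_derivative (f \<circ> inv_into U \<phi>) (at (\<phi> p)) (fst u))) (at (map_prod \<phi> \<psi> (p, q)))"
      by (rule has_derivative_transform_within_open[OF _ o])
        (use c in \<open>auto simp: inv_into_prod_chart[OF c(1,2)]\<close>)
    from P.coordinate_vector_eqI[OF smooth_near_fst[OF True pq(2)] this]
    show ?thesis unfolding ab by (simp add: coordinate_vector_def True)
  qed (simp add: ab coordinate_vector_def smooth_near_fst_iff pq)
  then show "(\<lambda>f. v (\<lambda>z. f (fst z))) \<in> tangent_space M p"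
    unfolding tangent_space_eq by (intro CollectI exI[of _ U] exI[of _ \<phi>] exI[of _ a] conjI ext c)
  have "v (\<lambda>z. g (snd z)) = coordinate_vector N V \<psi> q b g" for g
  proof (cases "g \<in> smooth_near N q")
    case True
    note d = N.smooth_near_has_derivative[OF True c(2,4)]
    have "((\<lambda>y. (g \<circ> inv_into V \<psi>) (snd y)) has_derivative
        (\<lambda>u. frechet_derivative (g \<circ> inv_into V \<psi>) (at (\<psi> q)) (snd u))) (at (map_prod \<phi> \<psi> (p, q)))"
      by (rule has_derivative_compose[OF bounded_linear_imp_has_derivative[OF bounded_linear_snd]])
        (simp only: map_prod_simp snd_conv, rule d)
    then have "((\<lambda>z. g (snd z)) \<circ> inv_into (U \<times> V) (map_prod \<phi> \<psi>) has_derivative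
        (\<lambda>u. frechet_derivative (g \<circ> inv_into V \<psi>) (at (\<psi> q)) (snd u))) (at (map_prod \<phi> \<psi> (p, q)))"
      by (rule has_derivative_transform_within_open[OF _ o])
        (use c in \<open>auto simp: inv_into_prod_chart[OF c(1,2)]\<close>)
    from P.coordinate_vector_eqI[OF smooth_near_snd[OF True pq(1)] this]
    show ?thesis unfolding ab by (simp add: coordinate_vector_def True)
  qed (simp add: ab coordinate_vector_def smooth_near_snd_iff pq)
  then show "(\<lambda>g. v (\<lambda>z. g (snd z))) \<in> tangent_space N q"
    unfolding tangent_space_eq by (intro CollectI exI[of _ V] exI[of _ \<psi>] exI[of _ b] conjI ext c)
qed

lemma lie_bracket_sum_field:
  assumes X: "X \<in> vector_fields M" "X' \<in> vector_fields M"
    and Y: "Y \<in> vector_fields N" "Y' \<in> vector_fields N"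
    and pq: "p \<in> points M" "q \<in> points N"
  shows "lie_bracket P (sum_field X Y) (sum_field X' Y') (p, q) (\<lambda>z. f (fst z)) = lie_bracket M X X' p f"
    and "lie_bracket P (sum_field X Y) (sum_field X' Y') (p, q) (\<lambda>z. g (snd z)) = lie_bracket N Y Y' q g"
proof -
  have t: "sum_field A B (p, q) \<in> tangent_space P (p, q)"
    if "A \<in> vector_fields M" "B \<in> vector_fields N" for A B
    using P.vector_field_tangent[OF sum_field_vector_field[OF that]] pq by (simp add: points_prod_manifold)
  have 1: "sum_field A B (p, q) (\<lambda>z. sum_field A' B' z (\<lambda>z. f (fst z))) = A p (\<lambda>x. A' x f)"
    if "A \<in> vector_fields M" "B \<in> vector_fields N" "A' \<in> vector_fields M" "B' \<in> vector_fields N" for A B A' B'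
  proof -
    have "sum_field A B (p, q) (\<lambda>z. sum_field A' B' z (\<lambda>z. f (fst z))) = sum_field A B (p, q) (\<lambda>z. A' (fst z) f)"
      by (rule P.tangent_vector_cong[OF t[OF that(1,2)]])
        (auto simp: points_prod_manifold sum_field_fst[OF that(3,4)])
    then show ?thesis using sum_field_fst[OF that(1,2) pq, of "\<lambda>x. A' x f"] by simp
  qed
  show "lie_bracket P (sum_field X Y) (sum_field X' Y') (p, q) (\<lambda>z. f (fst z)) = lie_bracket M X X' p f"
    using X Y by (simp add: lie_bracket_def smooth_near_fst_iff pq 1)
  have 2: "sum_field A B (p, q) (\<lambda>z. sum_field A' B' z (\<lambda>z. g (snd z))) = B q (\<lambda>y. B' y g)"
    if "A \<in> vector_fields M" "B \<in> vector_fields N" "A' \<in> vector_fields M" "B' \<in> vector_fields N" for A B A' B'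
  proof -
    have "sum_field A B (p, q) (\<lambda>z. sum_field A' B' z (\<lambda>z. g (snd z))) = sum_field A B (p, q) (\<lambda>z. B' (snd z) g)"
      by (rule P.tangent_vector_cong[OF t[OF that(1,2)]])
        (auto simp: points_prod_manifold sum_field_snd[OF that(3,4)])
    then show ?thesis using sum_field_snd[OF that(1,2) pq, of "\<lambda>y. B' y g"] by simp
  qed
  show "lie_bracket P (sum_field X Y) (sum_field X' Y') (p, q) (\<lambda>z. g (snd z)) = lie_bracket N Y Y' q g"
    using X Y by (simp add: lie_bracket_def smooth_near_snd_iff pq 2)
qed

end

lemma sum_1_8: "(\<Sum>i\<in>{1..8}. f i) = (\<Sum>i\<in>{1..5}. f i) + (\<Sum>i\<in>{6..8}. f i)" for f :: "nat \<Rightarrow> real"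
proof -
  have "{1..8} = {1..5} \<union> {6..8::nat}" by auto
  then show ?thesis by (simp add: sum.union_disjoint)
qed

locale framed_pair = charted_pair M N + M: framed M "{1..5}" e + N: framed N "{6..8}" k
  for M :: "('a, 'e::euclidean_space) manifold" and N :: "('b, 'f::euclidean_space) manifold" and e k
begin

abbreviation "F \<equiv> prod_frame M N e k"

lemma prod_frame_eq:
  "i \<le> 5 \<Longrightarrow> F i = sum_field (e i) (\<lambda>q g. 0)"
  "\<not> i \<le> 5 \<Longrightarrow> F i = sum_field (\<lambda>p f. 0) (k i)"
  by (auto simp: prod_frame_def sum_field_def pushforward_def fun_eq_iff)

lemma prod_frame_field: "i \<in> {1..8} \<Longrightarrow> F i \<in> vector_fields P"
  using sum_field_vector_field[OF M.frame_field N.zero_field] sum_field_vector_field[OF M.zero_field N.frame_field]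
  by (cases "i \<le> 5") (auto simp: prod_frame_eq)

lemma prod_frame_fst:
  assumes "p \<in> points M" "q \<in> points N" "i \<in> {1..8}"
  shows "F i (p, q) (\<lambda>z. f (fst z)) = (if i \<le> 5 then e i p f else 0)"
  using assms sum_field_fst[OF M.frame_field N.zero_field] sum_field_fst[OF M.zero_field N.frame_field]
  by (cases "i \<le> 5") (auto simp: prod_frame_eq)

lemma prod_frame_snd:
  assumes "p \<in> points M" "q \<in> points N" "i \<in> {1..8}"
  shows "F i (p, q) (\<lambda>z. g (snd z)) = (if i \<le> 5 then 0 else k i q g)"
  using assms sum_field_snd[OF M.frame_field N.zero_field] sum_field_snd[OF M.zero_field N.frame_field]
  by (cases "i \<le> 5") (auto simp: prod_frame_eq)

lemma prod_comb_fst: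
  assumes "p \<in> points M" "q \<in> points N"
  shows "(\<Sum>i\<in>{1..8}. c i * F i (p, q) (\<lambda>z. f (fst z))) = (\<Sum>i\<in>{1..5}. c i * e i p f)"
  unfolding sum_1_8 using assms by (simp add: prod_frame_fst)

lemma prod_comb_snd:
  assumes "p \<in> points M" "q \<in> points N"
  shows "(\<Sum>i\<in>{1..8}. c i * F i (p, q) (\<lambda>z. g (snd z))) = (\<Sum>i\<in>{6..8}. c i * k i q g)"
  unfolding sum_1_8 using assms by (simp add: prod_frame_snd)

lemma prod_comb_eqI:
  assumes "v \<in> tangent_space P (p, q)" and pq: "p \<in> points M" "q \<in> points N"
    and "\<And>f. v (\<lambda>z. f (fst z)) = (\<Sum>i\<in>{1..5}. c i * e i p f)"
    and "\<And>g. v (\<lambda>z. g (snd z)) = (\<Sum>i\<in>{6..8}. c i * k i q g)"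
  shows "v = (\<lambda>f. \<Sum>i\<in>{1..8}. c i * F i (p, q) f)"
proof (rule tangent_space_prod_eqI[OF assms(1) _ _ _ pq])
  show "(\<lambda>f. \<Sum>i\<in>{1..8}. c i * F i (p, q) f) \<in> tangent_space P (p, q)"
    using pq by (intro P.tangent_space_sum P.vector_field_tangent prod_frame_field)
      (auto simp: points_prod_manifold)
qed (simp_all only: assms(4,5) prod_comb_fst[OF pq] prod_comb_snd[OF pq])

lemma framed_prod: "framed P {1..8} F"
proof unfold_locales
  show "F i \<in> vector_fields P" if "i \<in> {1..8}" for i
    using prod_frame_field that .
  fix z assume "z \<in> points P"
  then obtain p q where z: "z = (p, q)" "p \<in> points M" "q \<in> points N"
    by (auto simp: points_prod_manifold)
  show "c i = 0" if *: "\<And>f. (\<Sum>i\<in>{1..8}. c i * F i z f) = 0" and i: "i \<in> {1..8}" for c i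
  proof (cases "i \<le> 5")
    case True
    then show ?thesis
      using M.frame_independent[OF z(2), of c i] *[unfolded z(1)] prod_comb_fst[OF z(2,3), of c] i by simp
  next
    case False
    then show ?thesis
      using N.frame_independent[OF z(3), of c i] *[unfolded z(1)] prod_comb_snd[OF z(2,3), of c] i by simp
  qed
  fix v assume v: "v \<in> tangent_space P z"
  note t = tangent_space_prod_components[OF v[unfolded z(1)] z(2,3)]
  obtain c d where c: "(\<lambda>f. v (\<lambda>z. f (fst z))) = M.comb c p" and d: "(\<lambda>g. v (\<lambda>z. g (snd z))) = N.comb d q"
    using M.frame_spans[OF t(1) z(2)] N.frame_spans[OF t(2) z(3)] by blast
  have "v = (\<lambda>f. \<Sum>i\<in>{1..8}. (if i \<le> 5 then c i else d i) * F i (p, q) f)"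
    by (rule prod_comb_eqI[OF v[unfolded z(1)] z(2,3)]) (use fun_cong[OF c] fun_cong[OF d] in simp_all)
  then show "\<exists>c. v = (\<lambda>f. \<Sum>i\<in>{1..8}. c i * F i z f)" unfolding z(1)
    by (rule exI[of _ "\<lambda>i. if i \<le> 5 then c i else d i"])
qed simp

lemma prod_frame_bracket:
  fixes cM cN
  defines "c p i j l \<equiv> if i \<le> 5 \<and> j \<le> 5 \<and> l \<le> 5 then cM p i j l
      else if \<not> i \<le> 5 \<and> \<not> j \<le> 5 \<and> \<not> l \<le> 5 then cN i j l else 0"
  assumes cM: "\<And>p i j. p \<in> points M \<Longrightarrow> i \<in> {1..5} \<Longrightarrow> j \<in> {1..5} \<Longrightarrow>
      lie_bracket M (e i) (e j) p = (\<lambda>f. \<Sum>l\<in>{1..5}. cM p i j l * e l p f)"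
    and cN: "\<And>q i j. q \<in> points N \<Longrightarrow> i \<in> {6..8} \<Longrightarrow> j \<in> {6..8} \<Longrightarrow>
      lie_bracket N (k i) (k j) q \<in> tangent_space N q \<Longrightarrow>
      lie_bracket N (k i) (k j) q = (\<lambda>f. \<Sum>l\<in>{6..8}. cN i j l * k l q f)"
    and field: "\<And>X Y. X \<in> vector_fields P \<Longrightarrow> Y \<in> vector_fields P \<Longrightarrow> lie_bracket P X Y \<in> vector_fields P"
    and z: "z \<in> points P" and i: "i \<in> {1..8}" and j: "j \<in> {1..8}"
  shows "lie_bracket P (F i) (F j) z = (\<lambda>f. \<Sum>l\<in>{1..8}. c (fst z) i j l * F l z f)"
proof -
  obtain p q where pq: "z = (p, q)" "p \<in> points M" "q \<in> points N"
    using z by (auto simp: points_prod_manifold)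
  define X where "X i = (if i \<le> 5 then e i else (\<lambda>p f. 0))" for i
  define Y where "Y i = (if i \<le> 5 then (\<lambda>q g. 0) else k i)" for i
  have F: "F i = sum_field (X i) (Y i)" for i by (simp add: X_def Y_def prod_frame_eq)
  have X: "X i \<in> vector_fields M" if "i \<in> {1..8}" for i
    using M.frame_field M.zero_field that by (simp add: X_def)
  have Y: "Y i \<in> vector_fields N" if "i \<in> {1..8}" for i
    using N.frame_field N.zero_field that by (simp add: Y_def)
  have t: "lie_bracket P (F i) (F j) (p, q) \<in> tangent_space P (p, q)"
    using P.vector_field_tangent[OF field[OF prod_frame_field[OF i] prod_frame_field[OF j]] z] pq(1) by simp
  note b = lie_bracket_sum_field[OF X[OF i] X[OF j] Y[OF i] Y[OF j] pq(2,3), folded F]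
  have tN: "lie_bracket N (Y i) (Y j) q \<in> tangent_space N q"
    using tangent_space_prod_components(2)[OF t pq(2,3)] unfolding b(2) by simp
  have bM: "lie_bracket M (X i) (X j) p f = (\<Sum>l\<in>{1..5}. c p i j l * e l p f)" for f
  proof (cases "i \<le> 5 \<and> j \<le> 5")
    case True
    then show ?thesis using fun_cong[OF cM[OF pq(2), of i j], of f] i j by (simp add: X_def c_def)
  next
    case False
    then have "X i = (\<lambda>p f. 0) \<or> X j = (\<lambda>p f. 0)" by (auto simp: X_def)
    then show ?thesis
      using False M.lie_bracket_zero[OF X[OF i] pq(2), of f] M.lie_bracket_zero[OF X[OF j] pq(2), of f]
      by (auto simp: c_def)
  qed
  have bN: "lie_bracket N (Y i) (Y j) q g = (\<Sum>l\<in>{6..8}. c p i j l * k l q g)" for g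
  proof (cases "\<not> i \<le> 5 \<and> \<not> j \<le> 5")
    case True
    then show ?thesis using fun_cong[OF cN[OF pq(3), of i j], of g] i j tN by (simp add: Y_def c_def)
  next
    case False
    then have "Y i = (\<lambda>q g. 0) \<or> Y j = (\<lambda>q g. 0)" by (auto simp: Y_def)
    then show ?thesis
      using False N.lie_bracket_zero[OF Y[OF i] pq(3), of g] N.lie_bracket_zero[OF Y[OF j] pq(3), of g]
      by (auto simp: c_def)
  qed
  show ?thesis
    unfolding pq(1) fst_conv by (rule prod_comb_eqI[OF t pq(2,3)]) (simp_all only: b bM bN)
qed

end

section \<open>Left-invariant frames\<close>

lemma lie_algebra_comb:
  assumes G: "lie_group G M" and e: "\<And>i. i \<in> I \<Longrightarrow> e i \<in> lie_algebra G M"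
  shows "(\<lambda>p f. \<Sum>i\<in>I. x i * e i p f) \<in> lie_algebra G M"
proof -
  interpret charted M
    using G by (simp add: lie_group_def smooth_manifold_imp_charted)
  have "pushforward M (\<lambda>q. a \<otimes>\<^bsub>G\<^esub> q) p (\<lambda>f. \<Sum>i\<in>I. x i * e i p f) = (\<lambda>f. \<Sum>i\<in>I. x i * e i (a \<otimes>\<^bsub>G\<^esub> p) f)"
    if "a \<in> carrier G" "p \<in> carrier G" for a p
  proof
    fix f
    have "e i (a \<otimes>\<^bsub>G\<^esub> p) f = pushforward M (\<lambda>q. a \<otimes>\<^bsub>G\<^esub> q) p (e i p) f" if "i \<in> I" for i
      using e[OF that] \<open>a \<in> carrier G\<close> \<open>p \<in> carrier G\<close> by (simp add: lie_algebra_def)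
    then show "pushforward M (\<lambda>q. a \<otimes>\<^bsub>G\<^esub> q) p (\<lambda>f. \<Sum>i\<in>I. x i * e i p f) f = (\<Sum>i\<in>I. x i * e i (a \<otimes>\<^bsub>G\<^esub> p) f)"
      by (simp add: pushforward_def)
  qed
  moreover have "(\<lambda>p f. \<Sum>i\<in>I. x i * e i p f) \<in> vector_fields M"
    using e by (intro vector_fields_sum) (simp add: lie_algebra_def)
  ultimately show ?thesis by (simp add: lie_algebra_def)
qed

text \<open>By left invariance a linear relation at one point holds everywhere, so the basis is
  independent at each point and spans the tangent space there for dimension reasons.\<close>

lemma lie_algebra_basis_imp_framed:
  fixes M :: "('a, 'e::euclidean_space) manifold"
  assumes G: "lie_group G M" and e: "lie_algebra_basis G M I e" and card: "card I = DIM('e)"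
  shows "framed M I e"
proof -
  have grp: "group G" and carrier: "carrier G = points M"
    using G by (simp_all add: lie_group_def)
  interpret G: group G by fact
  interpret charted M
    using G by (simp add: lie_group_def smooth_manifold_imp_charted)
  have fin: "finite I" and la: "\<And>i. i \<in> I \<Longrightarrow> e i \<in> lie_algebra G M"
    and uniq: "\<And>X. X \<in> lie_algebra G M \<Longrightarrow> \<exists>!x. x \<in> extensional I \<and> X = (\<lambda>p f. \<Sum>i\<in>I. x i * e i p f)"
    using e by (auto simp: lie_algebra_basis_def)
  have field: "e i \<in> vector_fields M" if "i \<in> I" for i
    using la[OF that] by (simp add: lie_algebra_def)
  have indep: "c i = 0" if p: "p \<in> points M" and c: "\<And>f. (\<Sum>i\<in>I. c i * e i p f) = 0" and i: "i \<in> I" for p c i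
  proof -
    have "(\<Sum>i\<in>I. c i * e i q f) = 0" for q f
    proof (cases "q \<in> points M")
      case True
      define a where "a = q \<otimes>\<^bsub>G\<^esub> inv\<^bsub>G\<^esub> p"
      have a: "a \<in> carrier G" "a \<otimes>\<^bsub>G\<^esub> p = q"
        using True p by (simp_all add: a_def G.m_assoc flip: carrier)
      have "pushforward M (\<lambda>q. a \<otimes>\<^bsub>G\<^esub> q) p (\<lambda>f. \<Sum>i\<in>I. c i * e i p f) = (\<lambda>f. \<Sum>i\<in>I. c i * e i (a \<otimes>\<^bsub>G\<^esub> p) f)"
        using lie_algebra_comb[OF G la, where x = c] a(1) p carrier by (simp add: lie_algebra_def)
      from fun_cong[OF this, of f] show ?thesis
        unfolding a(2) by (simp add: c pushforward_def split: if_splits)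
    next
      case False
      then show ?thesis using vector_field_outside[OF field] by simp
    qed
    then have zero: "(\<lambda>p f. \<Sum>i\<in>I. c i * e i p f) = (\<lambda>p f. 0)" by simp
    define Z where "Z = (\<lambda>p f. \<Sum>i\<in>I. c i * e i p f)"
    have "Z \<in> lie_algebra G M" unfolding Z_def by (rule lie_algebra_comb[OF G la])
    from uniq[OF this] obtain y where
      y: "\<And>x. x \<in> extensional I \<Longrightarrow> Z = (\<lambda>p f. \<Sum>i\<in>I. x i * e i p f) \<Longrightarrow> x = y" by blast
    have "restrict c I = y" by (rule y) (simp_all add: Z_def)
    moreover have "Z = (\<lambda>p f. \<Sum>i\<in>I. restrict (\<lambda>_. 0) I i * e i p f)" unfolding Z_def zero by simp
    then have "restrict (\<lambda>_. 0) I = y" by (intro y) simp_all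
    ultimately have "restrict c I = restrict (\<lambda>_. 0) I" by simp
    then show ?thesis using i by (metis restrict_apply')
  qed
  have span: "\<exists>c. v = (\<lambda>f. \<Sum>i\<in>I. c i * e i p f)" if v: "v \<in> tangent_space M p" and p: "p \<in> points M" for v p
  proof -
    obtain U \<phi> where c: "(U, \<phi>) \<in> atlas M" "p \<in> U" using ex_chart[OF p] by blast
    have "\<exists>a. e i p = coordinate_vector M U \<phi> p a" if "i \<in> I" for i
      using tangent_space_chartE[OF vector_field_tangent[OF field[OF that] p] c] by metis
    then obtain a where a: "\<And>i. i \<in> I \<Longrightarrow> e i p = coordinate_vector M U \<phi> p (a i)" by metis
    have comb: "(\<lambda>f. \<Sum>i\<in>I. x i * e i p f) = coordinate_vector M U \<phi> p (\<Sum>i\<in>I. x i *\<^sub>R a i)" for x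
      by (auto simp: coordinate_vector_sum[OF c] a)
    note zero = coordinate_vector_zero[OF c]
    have lin: "x i = 0" if "(\<Sum>i\<in>I. x i *\<^sub>R a i) = 0" "i \<in> I" for x i
      using indep[OF p _ that(2), of x] fun_cong[OF comb[of x]] unfolding that(1) zero by simp
    have inj: "inj_on a I"
    proof (rule inj_onI, rule ccontr)
      fix i j assume ij: "i \<in> I" "j \<in> I" "a i = a j" "i \<noteq> j"
      have "(\<Sum>l\<in>I. (if l = i then 1 else if l = j then - 1 else 0) *\<^sub>R a l)
          = (\<Sum>l\<in>I. (if l = i then a i else 0) - (if l = j then a j else 0))"
        using ij by (intro sum.cong) auto
      also have "\<dots> = 0" using ij fin by (simp add: sum_subtractf)
      finally show False using lin[of "\<lambda>l. if l = i then 1 else if l = j then - 1 else 0" i] ij by simp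
    qed
    have "independent (a ` I)"
    proof (rule independent_if_scalars_zero)
      fix x u assume s: "(\<Sum>u\<in>a ` I. x u *\<^sub>R u) = 0" and u: "u \<in> a ` I"
      then show "x u = 0" using lin[of "\<lambda>i. x (a i)"] by (auto simp: sum.reindex[OF inj])
    qed (use fin in simp)
    then have "UNIV \<subseteq> span (a ` I)"
      by (intro card_ge_dim_independent) (auto simp: card_image[OF inj] card)
    obtain w where w: "v = coordinate_vector M U \<phi> p w" using tangent_space_chartE[OF v c] .
    have "w \<in> span (a ` I)" using \<open>UNIV \<subseteq> span (a ` I)\<close> by blast
    then obtain x where "w = (\<Sum>u\<in>a ` I. x u *\<^sub>R u)"
      using fin by (auto simp: span_finite)
    then have "v = (\<lambda>f. \<Sum>i\<in>I. x (a i) * e i p f)"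
      unfolding w comb by (simp add: sum.reindex[OF inj])
    then show ?thesis by (rule exI[of _ "\<lambda>i. x (a i)"])
  qed
  show ?thesis
    by unfold_locales (fact fin field indep span)+
qed

lemma lie_bracket_R3:
  assumes K: "lie_group K N" and iso: "lie_isomorphic K N R3_group R3_manifold"
    and XY: "X \<in> lie_algebra K N" "Y \<in> lie_algebra K N"
    and q: "q \<in> points N" and t: "lie_bracket N X Y q \<in> tangent_space N q"
  shows "lie_bracket N X Y q = (\<lambda>f. 0)"
proof -
  have grp: "group K" and carrier: "carrier K = points N"
    using K by (simp_all add: lie_group_def)
  interpret K: group K by fact
  interpret charted N
    using K by (simp add: lie_group_def smooth_manifold_imp_charted)
  obtain F where F: "F \<in> iso K R3_group" and sF: "smooth_map N R3_manifold F"
    and sG: "smooth_map R3_manifold N (inv_into (carrier K) F)"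
    using iso by (auto simp: lie_isomorphic_def)
  define G where "G = inv_into (carrier K) F"
  have hom: "F (a \<otimes>\<^bsub>K\<^esub> b) = F a + F b" if "a \<in> points N" "b \<in> points N" for a b
    using F that carrier by (auto simp: iso_def hom_def R3_group_def)
  have GF: "G (F x) = x" if "x \<in> points N" for x
    using F that carrier by (auto simp: iso_def G_def bij_betw_def)
  have H: "smooth_on (\<phi> ` U) (F \<circ> inv_into U \<phi>)" if "(U, \<phi>) \<in> atlas N" for U \<phi>
    using sF that by (fastforce simp: smooth_map_def R3_manifold_def)
  have Fb: "smooth_fun_on N (points N) (\<lambda>x. F x \<bullet> b)" for b
  proof (rule smooth_fun_onI)
    fix U \<phi> assume c: "(U, \<phi>) \<in> atlas N" and o: "open (\<phi> ` (points N \<inter> U))"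
    have "points N \<inter> U = U" using chart_subset[OF c] by blast
    then show "smooth_on (\<phi> ` (points N \<inter> U)) ((\<lambda>x. F x \<bullet> b) \<circ> inv_into U \<phi>)"
      using smooth_on_inner[OF _ H[OF c] smooth_on_const, of b] o by (simp add: o_def)
  qed simp
  have Fn: "(\<lambda>x. F x \<bullet> b) \<in> smooth_near N p" if "p \<in> points N" for b p
    using Fb that unfolding smooth_near_def by blast
  have const: "X p (\<lambda>x. F x \<bullet> b) = X \<one>\<^bsub>K\<^esub> (\<lambda>x. F x \<bullet> b)" if X: "X \<in> lie_algebra K N" and p: "p \<in> points N" for X p b
  proof -
    have one: "\<one>\<^bsub>K\<^esub> \<in> points N" using K.one_closed carrier by simp
    have v: "X \<one>\<^bsub>K\<^esub> \<in> tangent_space N \<one>\<^bsub>K\<^esub>"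
      using X one vector_field_tangent by (simp add: lie_algebra_def)
    have "X p = pushforward N (\<lambda>q. p \<otimes>\<^bsub>K\<^esub> q) \<one>\<^bsub>K\<^esub> (X \<one>\<^bsub>K\<^esub>)"
      using X p one carrier K.r_one by (simp add: lie_algebra_def)
    then have "X p (\<lambda>x. F x \<bullet> b) = X \<one>\<^bsub>K\<^esub> (\<lambda>q. F (p \<otimes>\<^bsub>K\<^esub> q) \<bullet> b)"
      using Fn[OF p] p carrier K.r_one by (simp add: pushforward_def o_def)
    also have "\<dots> = X \<one>\<^bsub>K\<^esub> (\<lambda>q. F p \<bullet> b + F q \<bullet> b)"
      by (rule tangent_vector_cong[OF v]) (simp add: hom[OF p] inner_add_left)
    also have "\<dots> = X \<one>\<^bsub>K\<^esub> (\<lambda>q. F q \<bullet> b)"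
      using tangent_vector_add[OF v smooth_near_const[OF one] Fn[OF one], of "F p \<bullet> b" b]
        tangent_vector_const[OF v] by simp
    finally show ?thesis .
  qed
  have zero: "X q (\<lambda>p. Y p (\<lambda>x. F x \<bullet> b)) = 0" if "X \<in> lie_algebra K N" "Y \<in> lie_algebra K N" for X Y b
  proof -
    have v: "X q \<in> tangent_space N q" using that(1) q vector_field_tangent by (simp add: lie_algebra_def)
    have "X q (\<lambda>p. Y p (\<lambda>x. F x \<bullet> b)) = X q (\<lambda>p. Y \<one>\<^bsub>K\<^esub> (\<lambda>x. F x \<bullet> b))"
      by (rule tangent_vector_cong[OF v]) (rule const[OF that(2)])
    then show ?thesis using tangent_vector_const[OF v] by simp
  qed
  obtain U \<phi> where c: "(U, \<phi>) \<in> atlas N" "q \<in> U" using ex_chart[OF q] by blast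
  obtain a where a: "lie_bracket N X Y q = coordinate_vector N U \<phi> q a"
    using tangent_space_chartE[OF t c] .
  define H' where "H' = frechet_derivative (F \<circ> inv_into U \<phi>) (at (\<phi> q))"
  have H': "((F \<circ> inv_into U \<phi>) has_derivative H') (at (\<phi> q))"
    unfolding H'_def using smooth_on_has_derivative[OF H[OF c(1)]] c(2) by blast
  have "H' a \<bullet> b = 0" for b
  proof -
    have "((\<lambda>x. F x \<bullet> b) \<circ> inv_into U \<phi> has_derivative (\<lambda>v. H' v \<bullet> b)) (at (\<phi> q))"
      using has_derivative_inner_left[OF H', of b] by (simp add: o_def)
    from coordinate_vector_eqI[OF Fn[OF q] this, of a] show ?thesis
      using zero[OF XY] zero[OF XY(2,1)] Fn[OF q] by (simp add: lie_bracket_def flip: a)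
  qed
  then have "H' a = 0" by (metis inner_eq_zero_iff)
  have "smooth_on (G -` U) (\<phi> \<circ> G)"
    using sG c(1) unfolding smooth_map_def R3_manifold_def G_def by (fastforce simp: inv_id id_def o_def)
  then obtain J where J: "((\<phi> \<circ> G) has_derivative J) (at (F q))"
    using smooth_on_has_derivative[of "G -` U" "\<phi> \<circ> G" "F q"] c(2) GF[OF q] by auto
  have inv: "inv_into U \<phi> (\<phi> x) = x" if "x \<in> U" for x using chart_inj[OF c(1)] that by simp
  have "(F \<circ> inv_into U \<phi>) (\<phi> q) = F q" using inv[OF c(2)] by simp
  then have "((\<lambda>y. (\<phi> \<circ> G) ((F \<circ> inv_into U \<phi>) y)) has_derivative (\<lambda>v. J (H' v))) (at (\<phi> q))"
    using has_derivative_compose[OF H', of "\<phi> \<circ> G" J] J by metis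
  then have "((\<lambda>y. y) has_derivative (\<lambda>v. J (H' v))) (at (\<phi> q))"
    by (rule has_derivative_transform_within_open[OF _ chart_image_openin[OF c(1)]])
      (use c inv GF chart_subset[OF c(1)] in auto)
  then have "(\<lambda>v. J (H' v)) = (\<lambda>v. v)"
    using has_derivative_unique has_derivative_ident by blast
  then have "a = J (H' a)" by metis
  also have "\<dots> = 0" using \<open>H' a = 0\<close> linear_0[OF has_derivative_linear[OF J]] by simp
  finally show ?thesis
    unfolding a by (simp add: coordinate_vector_zero[OF c])
qed

section \<open>The cubic forms\<close>

lemma su3_cubic_eq:
  "su3_cubic x = complex_of_real (so3_cubic x
     + 3 * (x 1 * ((x 8)\<^sup>2 - (x 6)\<^sup>2 / 2 - (x 7)\<^sup>2 / 2) + sqrt 3 / 2 * x 4 * ((x 6)\<^sup>2 - (x 7)\<^sup>2)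
       + sqrt 3 * (x 2 * x 6 * x 7 - x 3 * x 6 * x 8 + x 5 * x 7 * x 8)))"
proof -
  define s where "s = complex_of_real (sqrt 3)"
  have s2: "s * s = 3" unfolding s_def by (simp flip: of_real_mult)
  have s3: "s * (s * z) = 3 * z" for z using s2 by (simp flip: mult.assoc)
  show ?thesis
    unfolding su3_cubic_def so3_cubic_def Let_def det_3 s_def[symmetric]
    by (simp add: power2_eq_square field_simps s2 s3 flip: s_def)
qed

lemma polarization_su3:
  assumes "w 6 = 0" "w 7 = 0" "w 8 = 0"
  shows "polarization (\<lambda>x. Re (su3_cubic x)) w x x = polarization so3_cubic w x x
    + (w 1 * ((x 8)\<^sup>2 - (x 6)\<^sup>2 / 2 - (x 7)\<^sup>2 / 2) + sqrt 3 / 2 * w 4 * ((x 6)\<^sup>2 - (x 7)\<^sup>2)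
       + sqrt 3 * (w 2 * x 6 * x 7 - w 3 * x 6 * x 8 + w 5 * x 7 * x 8))"
  unfolding polarization_def su3_cubic_eq Re_complex_of_real assms
  by (simp add: assms algebra_simps power2_eq_square add_divide_distrib diff_divide_distrib)

lemma quadratic_forms_independent:
  assumes "\<And>a b c :: real. w 1 * (c\<^sup>2 - a\<^sup>2 / 2 - b\<^sup>2 / 2) + sqrt 3 / 2 * w 4 * (a\<^sup>2 - b\<^sup>2)
      + sqrt 3 * (w 2 * a * b - w 3 * a * c + w 5 * b * c) = 0"
    and "i \<in> {1..5::nat}"
  shows "w i = 0"
proof -
  have 1: "w 1 = 0" using assms(1)[of 1 0 0] by simp
  have 4: "w 4 = 0" using assms(1)[of 0 1 0] 1 by simp
  have 2: "w 2 = 0" using assms(1)[of 0 1 1] 1 4 by simp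
  have 3: "w 3 = 0" using assms(1)[of 1 1 0] 1 4 by simp
  have 5: "w 5 = 0" using assms(1)[of 1 0 1] 1 4 by simp
  have "i = 1 \<or> i = 2 \<or> i = 3 \<or> i = 4 \<or> i = 5" using assms(2) by auto
  with 1 2 3 4 5 show ?thesis by auto
qed

definition so3_structure_constant :: "nat \<Rightarrow> nat \<Rightarrow> nat \<Rightarrow> real" where
  "so3_structure_constant i j l =
     (if (i, j, l) \<in> {(6, 7, 8), (7, 8, 6), (8, 6, 7)} then 1
      else if (i, j, l) \<in> {(7, 6, 8), (8, 7, 6), (6, 8, 7)} then - 1 else 0)"

lemma sum_6_8: "(\<Sum>i\<in>{6..8}. f i) = f 6 + f 7 + f 8" for f :: "nat \<Rightarrow> real"
proof -
  have "{6..8} = {6, 7, 8::nat}" by auto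
  then show ?thesis by simp
qed

lemma so3_bracket:
  assumes b: "lie_bracket N (k 6) (k 7) = k 8" "lie_bracket N (k 7) (k 8) = k 6" "lie_bracket N (k 8) (k 6) = k 7"
    and ij: "i \<in> {6..8}" "j \<in> {6..8}"
  shows "lie_bracket N (k i) (k j) q = (\<lambda>f. \<Sum>l\<in>{6..8}. so3_structure_constant i j l * k l q f)"
proof -
  have anti: "lie_bracket N X Y q f = - lie_bracket N Y X q f" for X Y f
    by (simp add: lie_bracket_def)
  have self: "lie_bracket N X X q f = 0" for X f
    by (simp add: lie_bracket_def)
  have "i = 6 \<or> i = 7 \<or> i = 8" "j = 6 \<or> j = 7 \<or> j = 8" using ij by auto
  then have "lie_bracket N (k i) (k j) q f = (\<Sum>l\<in>{6..8}. so3_structure_constant i j l * k l q f)" for f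
    by (elim disjE) (simp_all add: sum_6_8 so3_structure_constant_def self b
        anti[of "k 7" "k 6"] anti[of "k 8" "k 7"] anti[of "k 6" "k 8"])
  then show ?thesis by (rule ext)
qed

theorem lemma9p1:
  fixes L :: "'l monoid" and M :: "('l, real^5) manifold"
    and K :: "'k monoid" and N :: "('k, real^3) manifold"
    and e :: "nat \<Rightarrow> 'l vector_field" and k :: "nat \<Rightarrow> 'k vector_field"
    and T :: "'l trilinear_tensor" and T' :: "('l \<times> 'k) trilinear_tensor"
    and D :: "'l vector_field \<Rightarrow> 'l vector_field \<Rightarrow> 'l vector_field"
    and D' :: "('l \<times> 'k) vector_field \<Rightarrow> ('l \<times> 'k) vector_field \<Rightarrow> ('l \<times> 'k) vector_field"
  assumes L: "lie_group L M" "connected_space (mtop M)"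
    and e: "lie_algebra_basis L M {1..5} e"
    and T: "so3_tensor M e T"
    and D: "levi_civita M (frame_metric {1..5} e) D"
    and nearly_integrable_L: "nearly_integrable M D T"
    and K: "lie_group K N"
    and k: "lie_algebra_basis K N {6..8} k"
    and K_cases: "lie_isomorphic K N R3_group R3_manifold \<or>
       lie_isomorphic K N SO3_group SO3_manifold \<and>
       lie_bracket N (k 6) (k 7) = k 8 \<and>
       lie_bracket N (k 7) (k 8) = k 6 \<and>
       lie_bracket N (k 8) (k 6) = k 7"
    and T': "su3_tensor (prod_manifold M N) (prod_frame M N e k) T'"
    and D': "levi_civita (prod_manifold M N) (frame_metric {1..8} (prod_frame M N e k)) D'"
  shows "nearly_integrable (prod_manifold M N) D' T' \<longleftrightarrow>
    (\<forall>X\<in>lie_algebra L M. D X X = (\<lambda>p f. 0))"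
proof -
  interpret M: framed M "{1..5}" e
    by (rule lie_algebra_basis_imp_framed[OF L(1) e]) simp
  interpret N: framed N "{6..8}" k
    by (rule lie_algebra_basis_imp_framed[OF K k]) simp
  interpret framed_pair M N e k ..
  interpret P: framed P "{1..8}" F by (rule framed_prod)
  have "\<exists>c. lie_bracket M (e i) (e j) p = M.comb c p" if "p \<in> points M" "i \<in> {1..5}" "j \<in> {1..5}" for p i j
    by (rule M.frame_spans[OF M.vector_field_tangent[OF levi_civita_lie_bracket[OF M.charted_axioms D]]])
      (use that M.frame_field in auto)
  then have ex: "lie_bracket M (e i) (e j) p = M.comb (SOME c. lie_bracket M (e i) (e j) p = M.comb c p) p"
    if "p \<in> points M" "i \<in> {1..5}" "j \<in> {1..5}" for p i j
    by (rule someI_ex[of "\<lambda>c. lie_bracket M (e i) (e j) p = M.comb c p"]) (use that in auto)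
  define c where "c p i j = (SOME c. lie_bracket M (e i) (e j) p = M.comb c p)" for p i j
  note c = ex[folded c_def]
  have k_inv: "k i \<in> lie_algebra K N" if "i \<in> {6..8}" for i
    using k that by (simp add: lie_algebra_basis_def)
  obtain s :: real where s: "\<And>q i j. q \<in> points N \<Longrightarrow> i \<in> {6..8} \<Longrightarrow> j \<in> {6..8} \<Longrightarrow>
      lie_bracket N (k i) (k j) q \<in> tangent_space N q \<Longrightarrow>
      lie_bracket N (k i) (k j) q = N.comb (\<lambda>l. s * so3_structure_constant i j l) q"
  proof (cases "lie_isomorphic K N R3_group R3_manifold")
    case True
    show thesis
    proof (rule that[of 0])
      fix q i j
      assume "q \<in> points N" "i \<in> {6..8}" "j \<in> {6..8}" "lie_bracket N (k i) (k j) q \<in> tangent_space N q"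
      from lie_bracket_R3[OF K True k_inv[OF this(2)] k_inv[OF this(3)] this(1,4)]
      show "lie_bracket N (k i) (k j) q = N.comb (\<lambda>l. 0 * so3_structure_constant i j l) q" by simp
    qed
  next
    case False
    then have b: "lie_bracket N (k 6) (k 7) = k 8" "lie_bracket N (k 7) (k 8) = k 6" "lie_bracket N (k 8) (k 6) = k 7"
      using K_cases by auto
    show thesis
      by (rule that[of 1]) (simp add: so3_bracket[OF b])
  qed
  define c' where "c' z i j l = (if i \<le> 5 \<and> j \<le> 5 \<and> l \<le> 5 then c (fst z) i j l
      else if \<not> i \<le> 5 \<and> \<not> j \<le> 5 \<and> \<not> l \<le> 5 then s * so3_structure_constant i j l else 0)" for z :: "'l \<times> 'k" and i j l
  have c': "lie_bracket P (F i) (F j) z = P.comb (c' z i j) z"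
    if "z \<in> points P" "i \<in> {1..8}" "j \<in> {1..8}" for z i j
    unfolding c'_def
    by (rule prod_frame_bracket[OF c s levi_civita_lie_bracket[OF P.charted_axioms D'] that])
  define w where "w p x = (\<lambda>l. - (\<Sum>i\<in>{1..5}. \<Sum>j\<in>{1..5}. c p i l j * x i * x j))" for p x
  define w' where "w' z x = (\<lambda>l. - (\<Sum>i\<in>{1..8}. \<Sum>j\<in>{1..8}. c' z i l j * x i * x j))" for z x
  have w'_low: "w' z x l = w (fst z) x l" if "l \<le> 5" for z x l
    using that unfolding w'_def w_def sum_1_8 by (simp add: c'_def)
  have w'_high: "w' z x 6 = 0" "w' z x 7 = 0" "w' z x 8 = 0" for z x
    unfolding w'_def sum_1_8 sum_6_8 by (simp_all add: c'_def so3_structure_constant_def)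
  have so3_restrict: "so3_cubic (restrict x {1..5}) = so3_cubic x" for x
    by (simp add: so3_cubic_def)
  have su3_restrict: "Re (su3_cubic (restrict x {1..8})) = Re (su3_cubic x)" for x
    by (simp add: su3_cubic_eq so3_cubic_def)
  have T_sym: "symmetric_3_tensor M T" and T'_sym: "symmetric_3_tensor P T'"
    using T T' by (simp_all add: so3_tensor_def su3_tensor_def)
  have T_cubic: "T p v v v = so3_cubic (frame_coord {1..5} e p v)"
    if "p \<in> points M" "v \<in> tangent_space M p" for p v
    using T that by (simp add: so3_tensor_def)
  have T'_cubic: "T' z v v v = Re (su3_cubic (frame_coord {1..8} F z v))"
    if "z \<in> points P" "v \<in> tangent_space P z" for z v
    using T' that unfolding su3_tensor_def by (metis Re_complex_of_real)
  have "nearly_integrable M D T \<longleftrightarrow> (\<forall>p\<in>points M. \<forall>x. polarization so3_cubic (w p x) x x = 0)"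
    unfolding w_def
    by (rule M.nearly_integrable_iff[where c = c and C = so3_cubic, OF D c T_sym T_cubic so3_restrict])
  then have so3: "polarization so3_cubic (w p x) x x = 0" if "p \<in> points M" for p x
    using nearly_integrable_L that by blast
  have "polarization so3_cubic (w' (p, q) x) x x = polarization so3_cubic (w p x) x x" for p q x
    by (simp add: polarization_def so3_cubic_def w'_low)
  then have pol: "polarization (\<lambda>x. Re (su3_cubic x)) (w' (p, q) x) x x =
     w p x 1 * ((x 8)\<^sup>2 - (x 6)\<^sup>2 / 2 - (x 7)\<^sup>2 / 2) + sqrt 3 / 2 * w p x 4 * ((x 6)\<^sup>2 - (x 7)\<^sup>2)
       + sqrt 3 * (w p x 2 * x 6 * x 7 - w p x 3 * x 6 * x 8 + w p x 5 * x 7 * x 8)"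
    if "p \<in> points M" for p q x
    by (simp add: polarization_su3 w'_high w'_low so3[OF that])
  have geo: "D (M.comb x) (M.comb x) p = M.comb (w p x) p" if "p \<in> points M" for p x
    unfolding w_def by (rule M.geodesic_comb[where c = c, OF D c that])
  have "nearly_integrable P D' T' \<longleftrightarrow>
      (\<forall>z\<in>points P. \<forall>x. polarization (\<lambda>x. Re (su3_cubic x)) (w' z x) x x = 0)"
    unfolding w'_def
    by (rule P.nearly_integrable_iff[where c = c' and C = "\<lambda>x. Re (su3_cubic x)",
          OF D' c' T'_sym T'_cubic su3_restrict])
  also have "\<dots> \<longleftrightarrow> (\<forall>p\<in>points M. \<forall>x. \<forall>i\<in>{1..5}. w p x i = 0)"
  proof (intro iffI ballI allI)
    fix z x assume "\<forall>p\<in>points M. \<forall>x. \<forall>i\<in>{1..5}. w p x i = 0" "z \<in> points P"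
    then show "polarization (\<lambda>x. Re (su3_cubic x)) (w' z x) x x = 0"
      by (cases z) (auto simp: pol points_prod_manifold)
  next
    fix p x i
    assume *: "\<forall>z\<in>points P. \<forall>x. polarization (\<lambda>x. Re (su3_cubic x)) (w' z x) x x = 0"
      and p: "p \<in> points M" and i: "i \<in> {1..5::nat}"
    have q: "\<one>\<^bsub>K\<^esub> \<in> points N"
      using K group.is_monoid monoid.one_closed unfolding lie_group_def by metis
    show "w p x i = 0"
    proof (rule quadratic_forms_independent[OF _ i])
      fix a b d :: real
      define y where "y = x(6 := a, 7 := b, 8 := d)"
      have w: "w p y = w p x" by (simp add: w_def y_def fun_eq_iff)
      show "w p x 1 * (d\<^sup>2 - a\<^sup>2 / 2 - b\<^sup>2 / 2) + sqrt 3 / 2 * w p x 4 * (a\<^sup>2 - b\<^sup>2)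
          + sqrt 3 * (w p x 2 * a * b - w p x 3 * a * d + w p x 5 * b * d) = 0"
        using *[rule_format, of "(p, \<one>\<^bsub>K\<^esub>)" y] p q pol[OF p, of "\<one>\<^bsub>K\<^esub>" y]
        unfolding w by (simp add: points_prod_manifold y_def)
    qed
  qed
  also have "\<dots> \<longleftrightarrow> (\<forall>X\<in>lie_algebra L M. D X X = (\<lambda>p f. 0))"
  proof (intro iffI ballI allI)
    fix X assume *: "\<forall>p\<in>points M. \<forall>x. \<forall>i\<in>{1..5}. w p x i = 0" and X: "X \<in> lie_algebra L M"
    obtain x where x: "X = M.comb x"
      using e X unfolding lie_algebra_basis_def by blast
    show "D X X = (\<lambda>p f. 0)"
    proof (intro ext)
      fix p f
      show "D X X p f = 0"
      proof (cases "p \<in> points M")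
        case True
        then show ?thesis
          using fun_cong[OF geo[OF True, of x]] * True by (simp add: x)
      next
        case False
        then show ?thesis
          using M.vector_field_outside[OF M.D_field[where c = c, OF D c M.comb_field M.comb_field]] by (simp add: x)
      qed
    qed
  next
    fix p x i
    assume *: "\<forall>X\<in>lie_algebra L M. D X X = (\<lambda>p f. 0)" and p: "p \<in> points M" and i: "i \<in> {1..5::nat}"
    have "M.comb x \<in> lie_algebra L M"
      using e by (intro lie_algebra_comb[OF L(1)]) (simp add: lie_algebra_basis_def)
    then have "D (M.comb x) (M.comb x) = (\<lambda>p f. 0)" using * by blast
    then have zero: "(\<lambda>f. 0) = M.comb (w p x) p" using geo[OF p, of x] by simp
    show "w p x i = 0"
      by (rule M.frame_independent[OF p _ i]) (rule fun_cong[OF zero, symmetric])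
  qed
  finally show ?thesis .
qed

end
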